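(* Let $(T(t))_{t\ge 0}$ be a bounded $C_0$-semigroup on a Hilbert space $X$ with generator $-A$, and assume that $\sigma(A)\cap i\mathbb{R}=\{0\}$ and that $\sup_{|s|\ge\eta}\|(is+A)^{-1}\|<\infty$ for some $\eta>0$. Then $$\lim_{t\to\infty}\|T(t)A(I+A)^{-1}\|=0.$$ More precisely, let $m:(0,1)\to(1,\infty)$ be a continuous decreasing function such that $$\|(is+A)^{-1}\|=O(m(|s|)),\qquad s\to 0.$$ Let $\varepsilon\in(0,1)$. Then $$\|T(t)A(I+A)^{-1}\|=O\left(m^{-1}(t^{1-\varepsilon})\right),\qquad t\to\infty.$$
   Context: The generator of the semigroup is $-A$, and $s$ is real. Under the hypotheses $m(s)\to\infty$ as $s\to 0+$; $m^{-1}$ denotes a right inverse of $m$ (that is, $m(m^{-1}(t))=t$), defined for all sufficiently large arguments. *)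

theory Defs
  imports "HOL-Analysis.Analysis" "HOL-Library.Landau_Symbols"
begin

class complex_vector = real_vector +
  fixes scaleC :: "complex \<Rightarrow> 'a \<Rightarrow> 'a" (infixr \<open>*\<^sub>C\<close> 75)
  assumes scaleC_add_right: "a *\<^sub>C (x + y) = a *\<^sub>C x + a *\<^sub>C y"
    and scaleC_add_left: "(a + b) *\<^sub>C x = a *\<^sub>C x + b *\<^sub>C x"
    and scaleC_scaleC: "a *\<^sub>C b *\<^sub>C x = (a * b) *\<^sub>C x"
    and scaleC_one: "1 *\<^sub>C x = x"
    and scaleR_scaleC: "r *\<^sub>R x = complex_of_real r *\<^sub>C x"

text \<open>The inner product is linear in the first argument.\<close>

class complex_inner = complex_vector + real_normed_vector +
  fixes cinner :: "'a \<Rightarrow> 'a \<Rightarrow> complex"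
  assumes cinner_commute: "cinner x y = cnj (cinner y x)"
    and cinner_add_left: "cinner (x + y) z = cinner x z + cinner y z"
    and cinner_scaleC_left: "cinner (a *\<^sub>C x) y = a * cinner x y"
    and cinner_self_nonneg: "0 \<le> Re (cinner x x)"
    and cinner_self_eq_zero_iff: "cinner x x = 0 \<longleftrightarrow> x = 0"
    and norm_eq_sqrt_cinner: "norm x = sqrt (Re (cinner x x))"

class chilbert_space = complex_inner + complete_space

instantiation complex :: chilbert_space
begin

definition scaleC_complex :: "complex \<Rightarrow> complex \<Rightarrow> complex"
  where "scaleC_complex a x = a * x"

definition cinner_complex :: "complex \<Rightarrow> complex \<Rightarrow> complex"
  where "cinner_complex x y = x * cnj y"

instance
proof
  fix a b x y z :: complex and r :: real
  show "a *\<^sub>C (x + y) = a *\<^sub>C x + a *\<^sub>C y"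
    by (simp add: scaleC_complex_def distrib_left)
  show "(a + b) *\<^sub>C x = a *\<^sub>C x + b *\<^sub>C x"
    by (simp add: scaleC_complex_def distrib_right)
  show "a *\<^sub>C b *\<^sub>C x = (a * b) *\<^sub>C x"
    by (simp add: scaleC_complex_def mult.assoc)
  show "1 *\<^sub>C x = x"
    by (simp add: scaleC_complex_def)
  show "r *\<^sub>R x = complex_of_real r *\<^sub>C x"
    by (simp add: scaleC_complex_def scaleR_conv_of_real)
  show "cinner x y = cnj (cinner y x)"
    by (simp add: cinner_complex_def mult.commute)
  show "cinner (x + y) z = cinner x z + cinner y z"
    by (simp add: cinner_complex_def distrib_right)
  show "cinner (a *\<^sub>C x) y = a * cinner x y"
    by (simp add: cinner_complex_def scaleC_complex_def mult.assoc)
  show "0 \<le> Re (cinner x x)"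
    by (simp add: cinner_complex_def)
  show "cinner x x = 0 \<longleftrightarrow> x = 0"
    by (simp add: cinner_complex_def)
  show "norm x = sqrt (Re (cinner x x))"
    by (simp add: cinner_complex_def cmod_def power2_eq_square)
qed

end

definition bounded_clinear :: "('a::complex_inner \<Rightarrow> 'a) \<Rightarrow> bool"
  where "bounded_clinear f \<longleftrightarrow> bounded_linear f \<and> (\<forall>c x. f (c *\<^sub>C x) = c *\<^sub>C f x)"

text \<open>Only the values \<open>T t\<close> with \<open>t \<ge> 0\<close> matter.\<close>

definition C0_semigroup :: "(real \<Rightarrow> 'a::complex_inner \<Rightarrow> 'a) \<Rightarrow> bool"
  where "C0_semigroup T \<longleftrightarrow>
    (\<forall>t\<ge>0. bounded_clinear (T t)) \<and>
    (\<forall>x. T 0 x = x) \<and>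
    (\<forall>s\<ge>0. \<forall>t\<ge>0. \<forall>x. T (s + t) x = T s (T t x)) \<and>
    (\<forall>x. ((\<lambda>t. T t x) \<longlongrightarrow> x) (at_right 0))"

definition bounded_semigroup :: "(real \<Rightarrow> 'a::complex_inner \<Rightarrow> 'a) \<Rightarrow> bool"
  where "bounded_semigroup T \<longleftrightarrow> (\<exists>M. \<forall>t\<ge>0. onorm (T t) \<le> M)"

text \<open>An unbounded operator is given by its domain \<open>D\<close> and a function \<open>G\<close>
  whose values outside \<open>D\<close> are irrelevant.\<close>

definition is_generator ::
    "(real \<Rightarrow> 'a::complex_inner \<Rightarrow> 'a) \<Rightarrow> 'a set \<Rightarrow> ('a \<Rightarrow> 'a) \<Rightarrow> bool"
  where "is_generator T D G \<longleftrightarrow>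
    D = {x. \<exists>y. ((\<lambda>h. (T h x - x) /\<^sub>R h) \<longlongrightarrow> y) (at_right 0)} \<and>
    (\<forall>x\<in>D. ((\<lambda>h. (T h x - x) /\<^sub>R h) \<longlongrightarrow> G x) (at_right 0))"

text \<open>Meant for an operator \<open>A\<close> that is linear on a subspace \<open>D\<close>;
  the inverse of \<open>z - A\<close> is then complex linear as soon as it exists.\<close>

definition spectrum :: "'a::complex_inner set \<Rightarrow> ('a \<Rightarrow> 'a) \<Rightarrow> complex set"
  where "spectrum D A = - {z. bij_betw (\<lambda>x. z *\<^sub>C x - A x) D UNIV \<and>
    bounded_linear (inv_into D (\<lambda>x. z *\<^sub>C x - A x))}"

text \<open>\<open>(z + A)\<^sup>-\<^sup>1\<close>, meaningful if \<open>- z\<close> is not in the spectrum of \<open>A\<close>.\<close>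

definition shift_inv :: "'a::complex_inner set \<Rightarrow> ('a \<Rightarrow> 'a) \<Rightarrow> complex \<Rightarrow> 'a \<Rightarrow> 'a"
  where "shift_inv D A z = inv_into D (\<lambda>x. z *\<^sub>C x + A x)"

text \<open>The domain of \<open>m\<close> is the interval \<open>(0,1)\<close>.\<close>

definition right_inverse_at_top :: "(real \<Rightarrow> real) \<Rightarrow> (real \<Rightarrow> real) \<Rightarrow> bool"
  where "right_inverse_at_top m n \<longleftrightarrow>
    (\<forall>\<^sub>F t in at_top. n t \<in> {0<..<1} \<and> m (n t) = t)"

end

theory Submission
  imports Defs
begin

text \<open>Let \<open>B = A (I + A)\<^sup>-\<^sup>1\<close>. Everything follows from one estimate (\<open>decay_estimate\<close>): if
  \<open>(\<i> s + A)\<^sup>-\<^sup>1\<close> has norm at most \<open>K\<close> for all \<open>\<bar>s\<bar> \<ge> d\<close>, then for every natural number \<open>k > 0\<close>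
  \<open>norm (T(L) B) \<le> C (1 / L + d + (K / L) ^ k)\<close>
  with a constant \<open>C\<close> depending only on the semigroup and on \<open>k\<close>.

  To prove it, multiply the orbit \<open>T(s) y\<close> on \<open>[0, L]\<close> by a cutoff \<open>\<chi>(s / L)\<close> that vanishes to
  order \<open>k\<close> at both ends, and let \<open>u\<close> be the product. Then \<open>u' + A u\<close> is \<open>1 / L\<close> times the orbit
  cut off by \<open>\<chi>'\<close>, and this repeats \<open>k\<close> times. On the Fourier side, a frequency
  \<open>\<bar>w\<bar> \<ge> d\<close> gains the factor \<open>K / L\<close> in each of the \<open>k\<close> steps. A frequency \<open>\<bar>w\<bar> < d\<close> gains
  from \<open>B\<close> instead, since \<open>A\<close> acts like \<open>- \<i> w\<close> up to a term of size \<open>1 / L\<close>. In a Hilbert space the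
  estimates for single frequencies add up to an estimate of the square mean of \<open>B u\<close>, and
  boundedness of \<open>T\<close> turns this into an estimate of \<open>T(L) B y\<close>. Fourier series on the interval
  suffice: the upper bounds use Bessel's inequality (\<open>bessel_inequality\<close>), and the lower
  bound uses Fejer means (\<open>parseval_lower_bound\<close>).

  For the qualitative claim take \<open>k = 1\<close>: for fixed \<open>d\<close> the resolvent is bounded on
  \<open>\<bar>s\<bar> \<ge> d\<close> (\<open>resolvent_bounded_on_compact\<close> covers the part below \<open>\<eta>\<close>), so the upper limit is at most
  \<open>C d\<close>. For the rate take \<open>d = m\<^sup>-\<^sup>1(t powr (1 - \<epsilon>))\<close>, where \<open>K\<close> is a multiple of
  \<open>t powr (1 - \<epsilon>)\<close>, and \<open>k \<ge> 1 / \<epsilon>\<close>, which makes the last term a multiple of \<open>1 / t\<close>. Finally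
  \<open>1 / t\<close> is itself at most a multiple of \<open>d\<close>: as \<open>0\<close> is in the spectrum, the resolvent at \<open>\<i> d\<close> has
  norm at least \<open>1 / d\<close> (\<open>resolvent_lower_bound\<close>).\<close>

instance chilbert_space \<subseteq> banach ..

section \<open>The complex inner product\<close>

lemma cinner_scaleC_right: "cinner x (a *\<^sub>C y) = cnj a * cinner x y"
  for x y :: "'a::complex_inner"
  by (metis cinner_commute cinner_scaleC_left complex_cnj_mult)

lemma cinner_add_right: "cinner x (y + z) = cinner x y + cinner x z"
  for x y z :: "'a::complex_inner"
  by (metis cinner_commute cinner_add_left complex_cnj_add)

lemma Re_cinner_commute: "Re (cinner x y) = Re (cinner y x)"
  for x y :: "'a::complex_inner"
  by (subst cinner_commute) simp

lemma Re_cinner_scaleC_right: "Re (cinner x (a *\<^sub>C y)) = Re (cinner (cnj a *\<^sub>C x) y)"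
  for x y :: "'a::complex_inner"
  by (simp add: cinner_scaleC_right cinner_scaleC_left)

lemma Re_cinner_self: "Re (cinner x x) = (norm x)\<^sup>2"
  for x :: "'a::complex_inner"
  by (simp add: norm_eq_sqrt_cinner cinner_self_nonneg)

lemma norm_scaleC: "norm (a *\<^sub>C x) = cmod a * norm x"
  for x :: "'a::complex_inner"
proof -
  have "cinner (a *\<^sub>C x) (a *\<^sub>C x) = of_real ((cmod a)\<^sup>2) * cinner x x"
    unfolding cinner_scaleC_left cinner_scaleC_right complex_norm_square by (simp only: mult_ac)
  then have "(norm (a *\<^sub>C x))\<^sup>2 = (cmod a * norm x)\<^sup>2"
    unfolding Re_cinner_self[symmetric] by (simp add: power_mult_distrib Re_cinner_self)
  then show ?thesis
    by simp
qed

lemma norm_add_square: "(norm (x + y))\<^sup>2 = (norm x)\<^sup>2 + 2 * Re (cinner x y) + (norm y)\<^sup>2"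
  for x y :: "'a::complex_inner"
  unfolding Re_cinner_self[symmetric]
  by (simp add: cinner_add_left cinner_add_right Re_cinner_commute[of y x])

text \<open>The Cauchy--Schwarz inequality for the real part comes for free: the norm
  satisfies the triangle inequality, and expanding the square of
  \<open>norm (x + y) \<le> norm x + norm y\<close> leaves exactly this.\<close>

lemma Re_cinner_le: "Re (cinner x y) \<le> norm x * norm y"
  for x y :: "'a::complex_inner"
proof -
  have "(norm (x + y))\<^sup>2 \<le> (norm x + norm y)\<^sup>2"
    by (simp add: norm_triangle_ineq)
  then show ?thesis
    unfolding norm_add_square by (simp add: power2_sum)
qed

interpretation scaleC: bounded_bilinear "scaleC :: complex \<Rightarrow> 'a::complex_inner \<Rightarrow> 'a"
proof
  fix a b :: complex and x y :: 'a and r :: real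
  show "(a + b) *\<^sub>C x = a *\<^sub>C x + b *\<^sub>C x" "a *\<^sub>C (x + y) = a *\<^sub>C x + a *\<^sub>C y"
    by (rule scaleC_add_left scaleC_add_right)+
  show "(r *\<^sub>R a) *\<^sub>C x = r *\<^sub>R (a *\<^sub>C x)" "a *\<^sub>C (r *\<^sub>R x) = r *\<^sub>R (a *\<^sub>C x)"
    unfolding scaleR_scaleC[where 'a = 'a] by (simp_all add: scaleC_scaleC scaleR_conv_of_real mult.commute)
  show "\<exists>K. \<forall>(a::complex) (x::'a). norm (a *\<^sub>C x) \<le> norm a * norm x * K"
    by (rule exI[of _ 1]) (simp add: norm_scaleC)
qed

interpretation Re_cinner: bounded_bilinear "\<lambda>x y::'a::complex_inner. Re (cinner x y)"
proof
  fix x x' y y' :: 'a and r :: real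
  show "Re (cinner (x + x') y) = Re (cinner x y) + Re (cinner x' y)"
    "Re (cinner x (y + y')) = Re (cinner x y) + Re (cinner x y')"
    by (simp_all add: cinner_add_left cinner_add_right)
  show "Re (cinner (r *\<^sub>R x) y) = r *\<^sub>R Re (cinner x y)"
    "Re (cinner x (r *\<^sub>R y)) = r *\<^sub>R Re (cinner x y)"
    by (simp_all add: scaleR_scaleC cinner_scaleC_left cinner_scaleC_right)
  have "\<bar>Re (cinner x y)\<bar> \<le> norm x * norm y" for x y :: 'a
    using Re_cinner_le[of x y] Re_cinner_le[of "(-1) *\<^sub>C x" y]
    by (simp add: cinner_scaleC_left norm_scaleC)
  then show "\<exists>K. \<forall>x y::'a. norm (Re (cinner x y)) \<le> norm x * norm y * K"
    by (intro exI[of _ 1]) simp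
qed

section \<open>Fourier series of continuous functions with values in a Hilbert space\<close>

definition character :: "int \<Rightarrow> real \<Rightarrow> complex"
  where "character n x = cis (2 * pi * of_int n * x)"

lemma norm_character [simp]: "norm (character n x) = 1"
  by (simp add: character_def)

lemma cnj_character [simp]: "cnj (character n x) = character (- n) x"
  by (simp add: character_def cis_cnj)

lemma character_mult: "character m x * character n x = character (m + n) x"
  by (simp add: character_def cis_mult ring_distribs)

lemma character_diff: "character n (x - y) = character n x * character (- n) y"
  by (simp add: character_def cis_mult ring_distribs)

lemma character_power: "character (int j) x = character 1 x ^ j"
  by (simp add: character_def Complex.DeMoivre mult_ac)

lemma character_0 [simp]: "character 0 x = 1"
  by (simp add: character_def)

lemma character_period: "character n 1 = 1" "character n 0 = 1"
  using cis_multiple_2pi[of "of_int n"] by (simp_all add: character_def)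

lemma has_vector_derivative_character:
  "(character n has_vector_derivative (2 * pi * n * \<i>) * character n x) (at x within S)"
proof -
  have "((\<lambda>x. exp (of_real x * (\<i> * of_real (2 * pi * n)))) has_vector_derivative
     (\<i> * of_real (2 * pi * n)) * exp (of_real x * (\<i> * of_real (2 * pi * n)))) (at x within S)"
    using has_vector_derivative_at_within[OF
        exp_scaleR_has_vector_derivative_left[of "\<i> * of_real (2 * pi * n)" x]]
    by (simp add: scaleR_conv_of_real)
  then show ?thesis
    unfolding character_def[abs_def] cis_conv_exp by (simp add: mult_ac)
qed

lemma continuous_on_character [continuous_intros]:
  "continuous_on S f \<Longrightarrow> continuous_on S (\<lambda>x. character n (f x))"
  unfolding character_def by (intro continuous_intros)

lemma integral_character: "integral {0..1} (character n) = (if n = 0 then 1 else 0)"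
proof (cases "n = 0")
  case False
  have "(character n has_integral
      character n 1 / (2 * pi * n * \<i>) - character n 0 / (2 * pi * n * \<i>)) {0..1}"
  proof (rule fundamental_theorem_of_calculus)
    fix x :: real
    have "((\<lambda>x. character n x / (2 * pi * n * \<i>)) has_vector_derivative
      (2 * pi * n * \<i>) * character n x / (2 * pi * n * \<i>)) (at x within {0..1})"
      by (intro has_vector_derivative_divide has_vector_derivative_character)
    then show "((\<lambda>x. character n x / (2 * pi * n * \<i>)) has_vector_derivative
      character n x) (at x within {0..1})"
      using False by simp
  qed simp
  then show ?thesis
    using False by (simp add: character_period integral_unique)
qed (simp add: character_def[abs_def])

definition fourier_coeff :: "(real \<Rightarrow> 'a::chilbert_space) \<Rightarrow> int \<Rightarrow> 'a"
  where "fourier_coeff f n = integral {0..1} (\<lambda>x. character (- n) x *\<^sub>C f x)"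

lemma continuous_on_scaleC [continuous_intros]:
  "continuous_on S a \<Longrightarrow> continuous_on S f \<Longrightarrow> continuous_on S (\<lambda>x. a x *\<^sub>C (f x :: 'a::complex_inner))"
  by (rule scaleC.continuous_on)

lemma integrable_character_scaleC:
  "continuous_on {0..1} f \<Longrightarrow> (\<lambda>x. character n x *\<^sub>C (f x :: 'a::chilbert_space)) integrable_on {0..1}"
  by (intro integrable_continuous_interval continuous_intros)

lemma fourier_coeff_bounded_linear:
  assumes "continuous_on {0..1} f" "bounded_linear B" "\<And>c x. B (c *\<^sub>C x) = c *\<^sub>C B x"
  shows "fourier_coeff (\<lambda>x. B (f x)) n = B (fourier_coeff f n)"
  using integral_linear[OF integrable_character_scaleC[OF assms(1)] assms(2), of "-n"]
  by (simp add: fourier_coeff_def o_def assms(3))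

lemma integral_Re_cinner_left:
  fixes f :: "real \<Rightarrow> 'a::chilbert_space"
  assumes "f integrable_on S"
  shows "integral S (\<lambda>x. Re (cinner (f x) y)) = Re (cinner (integral S f) y)"
  using integral_linear[OF assms Re_cinner.bounded_linear_left, of y] by (simp add: o_def)

lemma integral_norm_trig_polynomial:
  fixes a :: "int \<Rightarrow> 'a::chilbert_space"
  assumes "finite F"
  shows "integral {0..1} (\<lambda>x. (norm (\<Sum>n\<in>F. character n x *\<^sub>C a n))\<^sup>2) = (\<Sum>n\<in>F. (norm (a n))\<^sup>2)"
proof -
  have "(norm (\<Sum>n\<in>F. character n x *\<^sub>C a n))\<^sup>2
      = (\<Sum>n\<in>F. \<Sum>m\<in>F. Re (cinner (character (n - m) x *\<^sub>C a n) (a m)))" for x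
    unfolding Re_cinner_self[symmetric] Re_cinner.sum_left Re_cinner.sum_right
    by (subst sum.swap) (simp add: Re_cinner_scaleC_right scaleC_scaleC character_mult)
  then have "integral {0..1} (\<lambda>x. (norm (\<Sum>n\<in>F. character n x *\<^sub>C a n))\<^sup>2)
     = (\<Sum>n\<in>F. \<Sum>m\<in>F. integral {0..1} (\<lambda>x. Re (cinner (character (n - m) x *\<^sub>C a n) (a m))))"
    by (simp add: integral_sum assms integrable_sum integrable_continuous_interval
        Re_cinner.continuous_on continuous_intros)
  also have "\<dots> = (\<Sum>n\<in>F. \<Sum>m\<in>F. if m = n then (norm (a n))\<^sup>2 else 0)"
  proof (intro sum.cong refl)
    fix n m
    have "integral {0..1} (\<lambda>x. character (n - m) x *\<^sub>C a n)
        = integral {0..1} (character (n - m)) *\<^sub>C a n"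
      using integral_linear[OF _ scaleC.bounded_linear_left, of "character (n - m)" "{0..1}" "a n"]
      by (simp add: o_def integrable_continuous_interval continuous_intros)
    then show "integral {0..1} (\<lambda>x. Re (cinner (character (n - m) x *\<^sub>C a n) (a m)))
        = (if m = n then (norm (a n))\<^sup>2 else 0)"
      by (subst integral_Re_cinner_left)
        (auto simp: integrable_character_scaleC integral_character scaleC_one Re_cinner_self
          Re_cinner.zero_left scaleC.zero_left)
  qed
  also have "\<dots> = (\<Sum>n\<in>F. (norm (a n))\<^sup>2)"
    by (simp add: assms)
  finally show ?thesis .
qed

text \<open>The difference between \<open>f\<close> and its partial Fourier sum has a nonnegative square integral.\<close>

lemma bessel_inequality:
  fixes f :: "real \<Rightarrow> 'a::chilbert_space"
  assumes f: "continuous_on {0..1} f" and F: "finite F"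
  shows "(\<Sum>n\<in>F. (norm (fourier_coeff f n))\<^sup>2) \<le> integral {0..1} (\<lambda>x. (norm (f x))\<^sup>2)"
proof -
  define c where "c = fourier_coeff f"
  define P where "P = (\<lambda>x. \<Sum>n\<in>F. character n x *\<^sub>C c n)"
  have P: "continuous_on {0..1} P"
    unfolding P_def by (intro continuous_intros)
  have "Re (cinner (f x) (P x)) = (\<Sum>n\<in>F. Re (cinner (character (- n) x *\<^sub>C f x) (c n)))" for x
    by (simp add: P_def Re_cinner.sum_right Re_cinner_scaleC_right)
  then have "integral {0..1} (\<lambda>x. Re (cinner (f x) (P x)))
      = (\<Sum>n\<in>F. integral {0..1} (\<lambda>x. Re (cinner (character (- n) x *\<^sub>C f x) (c n))))"
    by (simp add: integral_sum F integrable_continuous_interval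
        Re_cinner.continuous_on continuous_intros f)
  also have "\<dots> = (\<Sum>n\<in>F. (norm (c n))\<^sup>2)"
    by (subst integral_Re_cinner_left)
      (auto simp: integrable_character_scaleC f fourier_coeff_def[symmetric] c_def Re_cinner_self)
  finally have fP: "integral {0..1} (\<lambda>x. Re (cinner (f x) (P x))) = (\<Sum>n\<in>F. (norm (c n))\<^sup>2)" .
  have PP: "integral {0..1} (\<lambda>x. (norm (P x))\<^sup>2) = (\<Sum>n\<in>F. (norm (c n))\<^sup>2)"
    unfolding P_def by (rule integral_norm_trig_polynomial[OF F])
  have "0 \<le> (norm (f x))\<^sup>2 - 2 * Re (cinner (f x) (P x)) + (norm (P x))\<^sup>2" for x
    using norm_add_square[of "f x" "- P x"] by (simp add: Re_cinner.minus_right) (metis zero_le_power2)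
  then have "0 \<le> integral {0..1} (\<lambda>x. (norm (f x))\<^sup>2 - 2 * Re (cinner (f x) (P x)) + (norm (P x))\<^sup>2)"
    by (intro integral_nonneg integrable_continuous_interval continuous_intros
        Re_cinner.continuous_on f P) auto
  also have "\<dots> = integral {0..1} (\<lambda>x. (norm (f x))\<^sup>2) - 2 * integral {0..1} (\<lambda>x. Re (cinner (f x) (P x)))
      + integral {0..1} (\<lambda>x. (norm (P x))\<^sup>2)"
  proof -
    have "(\<lambda>x. (norm (f x))\<^sup>2) integrable_on {0..1}" "(\<lambda>x. (norm (P x))\<^sup>2) integrable_on {0..1}"
      "(\<lambda>x. 2 * Re (cinner (f x) (P x))) integrable_on {0..1}"
      by (intro integrable_continuous_interval continuous_intros Re_cinner.continuous_on f P)+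
    then show ?thesis
      by (simp add: integral_add integral_diff integrable_diff)
  qed
  finally show ?thesis
    unfolding fP PP by (simp add: c_def)
qed

definition fejer_kernel :: "nat \<Rightarrow> real \<Rightarrow> real"
  where "fejer_kernel N x = (cmod (\<Sum>j<N. character (int j) x))\<^sup>2 / N"

text \<open>The first argument of the kernel is a difference of times, and here the two times are
  separated. This turns convolution with the kernel into a trigonometric polynomial whose
  coefficients are multiples of the Fourier coefficients of the other factor.\<close>

lemma fejer_kernel_expand:
  "complex_of_real (fejer_kernel N (t - s))
    = (\<Sum>j<N. \<Sum>k<N. character (int j - int k) t * character (- (int j - int k)) s) / N"
proof -
  have "complex_of_real ((cmod (\<Sum>j<N. character (int j) (t - s)))\<^sup>2)
    = (\<Sum>j<N. \<Sum>k<N. character (int j - int k) (t - s))"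
    by (simp add: complex_norm_square sum_product character_mult del: of_real_power)
  then show ?thesis
    by (simp add: fejer_kernel_def character_diff del: of_real_power)
qed

lemma continuous_on_fejer_kernel [continuous_intros]:
  "continuous_on S f \<Longrightarrow> continuous_on S (\<lambda>x. fejer_kernel N (f x))"
  unfolding fejer_kernel_def divide_inverse by (intro continuous_intros)

lemma integral_fejer_kernel:
  assumes "N > 0"
  shows "integral {0..1} (\<lambda>s. fejer_kernel N (t - s)) = 1"
proof -
  have "complex_of_real (integral {0..1} (\<lambda>s. fejer_kernel N (t - s)))
      = integral {0..1} (\<lambda>s. complex_of_real (fejer_kernel N (t - s)))"
    using integral_linear[OF _ bounded_linear_of_real, of "\<lambda>s. fejer_kernel N (t - s)" "{0..1}"]
    by (metis (no_types, lifting) comp_apply continuous_on_diff continuous_on_const continuous_on_id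
      continuous_on_fejer_kernel integrable_continuous_interval ext)
  also have "\<dots> = (\<Sum>j<N. \<Sum>k<N. character (int j - int k) t
      * integral {0..1} (character (- (int j - int k)))) / N"
    unfolding fejer_kernel_expand
    by (simp add: integral_sum integrable_sum integrable_continuous_interval continuous_intros
        continuous_on_character[OF continuous_on_id])
  also have "\<dots> = (\<Sum>j<N. \<Sum>k<N. if k = j then 1 else (0::complex)) / N"
    by (intro arg_cong2[where f = "(/)"] sum.cong refl) (auto simp: integral_character)
  also have "\<dots> = of_real 1"
    using assms by simp
  finally show ?thesis
    using of_real_eq_iff by blast
qed

text \<open>Away from the integers the geometric sum defining the kernel is bounded independently
  of its length. The upper limit \<open>3/4\<close> keeps \<open>x\<close> away from the next period; it is the
  largest distance between a point of \<open>[1/4, 3/4]\<close> and a point of \<open>[0, 1]\<close>.\<close>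

lemma fejer_kernel_bound:
  assumes "0 < d" "d \<le> 1"
  obtains C where "C \<ge> 0" "\<And>N x. d \<le> \<bar>x\<bar> \<Longrightarrow> \<bar>x\<bar> \<le> 3/4 \<Longrightarrow> fejer_kernel N x \<le> C / N"
proof -
  define S where "S = {- (3/4) .. - d} \<union> {d .. 3/4 :: real}"
  have ne: "character 1 x \<noteq> 1" if "x \<in> S" for x
  proof
    assume "character 1 x = 1"
    then obtain k :: int where "2 * pi * x = of_int (2 * k) * pi"
      by (auto simp: character_def cis_conv_exp exp_eq_1)
    then have "x = of_int k"
      by (simp add: field_simps)
    moreover from that have "\<bar>x\<bar> > 0" "\<bar>x\<bar> < 1"
      using assms by (auto simp: S_def)
    ultimately show False
      by simp
  qed
  have "compact S"
    unfolding S_def by (intro compact_Un compact_Icc)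
  moreover have "continuous_on S (\<lambda>x. 4 / (cmod (1 - character 1 x))\<^sup>2)"
    using ne by (intro continuous_intros) (metis norm_eq_zero power_eq_0_iff right_minus_eq)
  ultimately have "bounded ((\<lambda>x. 4 / (cmod (1 - character 1 x))\<^sup>2) ` S)"
    by (intro compact_imp_bounded compact_continuous_image)
  then obtain C where C: "C > 0" "\<And>x. x \<in> S \<Longrightarrow> \<bar>4 / (cmod (1 - character 1 x))\<^sup>2\<bar> \<le> C"
    unfolding bounded_pos by auto
  show thesis
  proof
    fix N x
    assume x: "d \<le> \<bar>x\<bar>" "\<bar>x\<bar> \<le> 3/4"
    then have S: "x \<in> S"
      by (auto simp: S_def)
    have "(\<Sum>j<N. character (int j) x) = (1 - character 1 x ^ N) / (1 - character 1 x)"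
      unfolding character_power using ne[OF S] by (simp add: sum_gp_strict)
    then have "cmod (\<Sum>j<N. character (int j) x) = cmod (1 - character 1 x ^ N) / cmod (1 - character 1 x)"
      by (simp add: norm_divide)
    also have "\<dots> \<le> 2 / cmod (1 - character 1 x)"
      using norm_triangle_ineq4[of 1 "character 1 x ^ N"]
      by (intro divide_right_mono) (auto simp: norm_power)
    finally have "(cmod (\<Sum>j<N. character (int j) x))\<^sup>2 \<le> (2 / cmod (1 - character 1 x))\<^sup>2"
      by (intro power_mono) auto
    also have "\<dots> \<le> C"
      using C(2)[OF S] by (simp add: power_divide)
    finally show "fejer_kernel N x \<le> C / N"
      unfolding fejer_kernel_def by (intro divide_right_mono) auto
  qed (use C in simp)
qed

text \<open>This replaces the completeness of the trigonometric system. The Fejer means \<open>p N\<close> of \<open>f\<close>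
  have square integral at most \<open>S\<close>, because they are averages of trigonometric
  polynomials built from Fourier coefficients of \<open>f\<close>, and they converge to \<open>f\<close> uniformly
  on \<open>[1/4, 3/4]\<close>. Near the endpoints they may fail to converge to \<open>f\<close>, since they have period
  one and \<open>f 0\<close> may differ from \<open>f 1\<close>. The factor \<open>2\<close> comes from \<open>(u + v)\<^sup>2 \<le> 2 u\<^sup>2 + 2 v\<^sup>2\<close>.\<close>

lemma parseval_lower_bound:
  fixes f :: "real \<Rightarrow> 'a::chilbert_space"
  assumes f: "continuous_on {0..1} f"
    and S: "\<And>F. finite F \<Longrightarrow> (\<Sum>n\<in>F. (norm (fourier_coeff f n))\<^sup>2) \<le> S"
  shows "integral {1/4..3/4} (\<lambda>x. (norm (f x))\<^sup>2) \<le> 2 * S"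
proof -
  define c where "c = fourier_coeff f"
  define p where "p = (\<lambda>N t. integral {0..1} (\<lambda>s. fejer_kernel N (t - s) *\<^sub>R f s))"
  have fs: "(\<lambda>s. character n s *\<^sub>C f s) integrable_on {0..1}" for n
    by (rule integrable_character_scaleC[OF f])
  have p_eq: "p N t = (1 / N) *\<^sub>R (\<Sum>j<N. \<Sum>k<N. character (int j - int k) t *\<^sub>C c (int j - int k))" for N t
  proof -
    have "fejer_kernel N (t - s) *\<^sub>R f s = (1 / N) *\<^sub>R (\<Sum>j<N. \<Sum>k<N.
        character (int j - int k) t *\<^sub>C (character (- (int j - int k)) s *\<^sub>C f s))" for s
      unfolding scaleR_scaleC[where 'a = 'a] fejer_kernel_expand
      by (simp add: scaleC_scaleC scaleC.sum_left scaleC.sum_right sum_divide_distrib)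
    then have "p N t = integral {0..1} (\<lambda>s. (1 / N) *\<^sub>R (\<Sum>j<N. \<Sum>k<N.
        character (int j - int k) t *\<^sub>C (character (- (int j - int k)) s *\<^sub>C f s)))"
      by (simp add: p_def)
    also have "\<dots> = (1 / N) *\<^sub>R (\<Sum>j<N. \<Sum>k<N. integral {0..1} (\<lambda>s.
        character (int j - int k) t *\<^sub>C (character (- (int j - int k)) s *\<^sub>C f s)))"
      by (subst integral_cmul, subst integral_sum)
        (auto intro!: integrable_sum integrable_continuous_interval continuous_intros f
          sum.cong integral_sum)
    also have "\<dots> = (1 / N) *\<^sub>R (\<Sum>j<N. \<Sum>k<N. character (int j - int k) t *\<^sub>C c (int j - int k))"
      using integral_linear[OF fs scaleC.bounded_linear_right]
      by (simp add: o_def c_def fourier_coeff_def)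
    finally show ?thesis .
  qed
  have p_cont: "continuous_on T (p N)" for T N
    unfolding p_eq[abs_def] by (intro continuous_intros)
  have p_norm: "integral {0..1} (\<lambda>t. (norm (p N t))\<^sup>2) \<le> S" if "N > 0" for N
  proof -
    \<comment> \<open>For fixed \<open>j\<close> the frequencies in \<open>q j\<close> are distinct, so its square integral is a sum of
      squared coefficients of \<open>f\<close>; the Fejer mean is the average of the \<open>q j\<close>.\<close>
    define q where "q = (\<lambda>j t. \<Sum>k<N. character (int j - int k) t *\<^sub>C c (int j - int k))"
    have q_cont: "continuous_on {0..1} (q j)" for j
      unfolding q_def by (intro continuous_intros)
    have q_norm: "integral {0..1} (\<lambda>t. (norm (q j t))\<^sup>2) \<le> S" for j
    proof -
      have "inj_on (\<lambda>k. int j - int k) {..<N}"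
        by (auto simp: inj_on_def)
      then have "q j = (\<lambda>t. \<Sum>n\<in>(\<lambda>k. int j - int k) ` {..<N}. character n t *\<^sub>C c n)"
        by (simp add: q_def sum.reindex)
      then show ?thesis
        using S[of "(\<lambda>k. int j - int k) ` {..<N}"]
        by (simp add: integral_norm_trig_polynomial c_def)
    qed
    have "(norm (p N t))\<^sup>2 \<le> (1 / N) * (\<Sum>j<N. (norm (q j t))\<^sup>2)" for t
    proof -
      have "(\<Sum>j<N. norm (q j t))\<^sup>2 \<le> real N * (\<Sum>j<N. (norm (q j t))\<^sup>2)"
        using Cauchy_Schwarz_ineq_sum[of "\<lambda>_. 1" "\<lambda>j. norm (q j t)" "{..<N}"] by simp
      moreover have "(norm (\<Sum>j<N. q j t))\<^sup>2 \<le> (\<Sum>j<N. norm (q j t))\<^sup>2"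
        by (intro power_mono norm_sum) auto
      ultimately have "(1 / N)\<^sup>2 * (norm (\<Sum>j<N. q j t))\<^sup>2 \<le> (1 / N)\<^sup>2 * (real N * (\<Sum>j<N. (norm (q j t))\<^sup>2))"
        by (intro mult_left_mono) auto
      moreover have "p N t = (1 / N) *\<^sub>R (\<Sum>j<N. q j t)"
        by (simp add: p_eq q_def)
      ultimately show ?thesis
        using that by (simp add: power_mult_distrib power_divide power2_eq_square)
    qed
    then have "integral {0..1} (\<lambda>t. (norm (p N t))\<^sup>2)
        \<le> integral {0..1} (\<lambda>t. (1 / N) * (\<Sum>j<N. (norm (q j t))\<^sup>2))"
      by (intro integral_le integrable_continuous_interval continuous_intros p_cont q_cont)
    also have "\<dots> = (1 / N) * (\<Sum>j<N. integral {0..1} (\<lambda>t. (norm (q j t))\<^sup>2))"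
      by (simp add: integral_sum integrable_continuous_interval continuous_intros q_cont)
    also have "\<dots> \<le> (1 / N) * (\<Sum>j<N. S)"
      by (intro mult_left_mono sum_mono q_norm) auto
    finally show ?thesis
      using that by simp
  qed
  have "bounded (f ` {0..1})"
    using f by (intro compact_imp_bounded compact_continuous_image) auto
  then obtain b where b: "b > 0" "\<And>x. 0 \<le> x \<Longrightarrow> x \<le> 1 \<Longrightarrow> norm (f x) \<le> b"
    unfolding bounded_pos by auto
  have unif: "uniformly_continuous_on {0..1} f"
    using f by (intro compact_uniformly_continuous) auto
  have approx: "integral {1/4..3/4} (\<lambda>x. (norm (f x))\<^sup>2) \<le> 2 * S + e" if "e > 0" for e
  proof -
    define e' where "e' = sqrt e / 2"
    have e': "e' > 0" "e'\<^sup>2 = e / 4"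
      using that by (simp_all add: e'_def power_divide)
    obtain d' where d': "d' > 0"
      "\<And>x y. x \<in> {0..1} \<Longrightarrow> y \<in> {0..1} \<Longrightarrow> dist y x < d' \<Longrightarrow> dist (f y) (f x) < e'"
      using unif e'(1) unfolding uniformly_continuous_on_def by metis
    define d where "d = min d' 1"
    have d: "0 < d" "d \<le> 1" "d \<le> d'"
      using d'(1) by (auto simp: d_def)
    obtain C where C: "C \<ge> 0" "\<And>N x. d \<le> \<bar>x\<bar> \<Longrightarrow> \<bar>x\<bar> \<le> 3/4 \<Longrightarrow> fejer_kernel N x \<le> C / N"
      using fejer_kernel_bound[OF d(1,2)] by blast
    obtain N :: nat where N: "real N > C * (2 * b) / e'" "N > 0"
      by (metis gt_ex max_less_iff_conj of_nat_0_less_iff reals_Archimedean2)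
    have CN: "C / N * (2 * b) \<le> e'"
      using N e'(1) by (simp add: field_simps)
    have close: "norm (f t - p N t) \<le> 2 * e'" if t: "1/4 \<le> t" "t \<le> 3/4" for t
    proof -
      have "f t = integral {0..1} (\<lambda>s. fejer_kernel N (t - s) *\<^sub>R f t)"
        using integral_linear[OF _ bounded_linear_scaleR_left, of "\<lambda>s. fejer_kernel N (t - s)" "{0..1}" "f t"]
          integral_fejer_kernel[OF N(2), of t]
        by (simp add: o_def integrable_continuous_interval continuous_intros)
      then have "f t - p N t = integral {0..1} (\<lambda>s. fejer_kernel N (t - s) *\<^sub>R (f t - f s))"
        unfolding p_def scaleR_diff_right
        by (subst integral_diff)
          (auto intro!: integrable_continuous_interval continuous_intros f)
      also have "norm \<dots> \<le> integral {0..1} (\<lambda>s. e' * fejer_kernel N (t - s) + e')"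
      proof (rule integral_norm_bound_integral)
        fix s :: real
        assume s: "s \<in> {0..1}"
        have pos: "0 \<le> fejer_kernel N (t - s)"
          by (simp add: fejer_kernel_def)
        show "norm (fejer_kernel N (t - s) *\<^sub>R (f t - f s)) \<le> e' * fejer_kernel N (t - s) + e'"
        proof (cases "\<bar>t - s\<bar> < d")
          case True
          then have "norm (f t - f s) \<le> e'"
            using d'(2)[of s t] d(3) s t by (auto simp: dist_norm intro: less_imp_le)
          then have "fejer_kernel N (t - s) * norm (f t - f s) \<le> fejer_kernel N (t - s) * e'"
            using pos by (rule mult_left_mono)
          then show ?thesis
            using pos e'(1) by (simp add: mult.commute)
        next
          case False
          have "norm (f t - f s) \<le> 2 * b"
            using norm_triangle_ineq4[of "f t" "f s"] b(2)[of t] b(2)[of s] s t by auto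
          moreover have "\<bar>t - s\<bar> \<le> 3/4"
            using s t unfolding atLeastAtMost_iff by arith
          then have "fejer_kernel N (t - s) \<le> C / N"
            using C(2)[of "t - s" N] False by linarith
          ultimately have "fejer_kernel N (t - s) * norm (f t - f s) \<le> C / N * (2 * b)"
            using pos by (intro mult_mono) (auto intro: C(1))
          also note CN
          finally show ?thesis
            using pos e'(1) by (simp add: add_increasing)
        qed
      qed (intro integrable_continuous_interval continuous_intros f)+
      also have "\<dots> = 2 * e'"
        using integral_fejer_kernel[OF N(2), of t]
        by (subst integral_add) (auto intro!: integrable_continuous_interval continuous_intros)
      finally show ?thesis .
    qed
    have "(norm (f t))\<^sup>2 \<le> 2 * (norm (p N t))\<^sup>2 + 2 * e" if "1/4 \<le> t" "t \<le> 3/4" for t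
    proof -
      have "norm (f t) \<le> norm (p N t) + 2 * e'"
        using close[OF that] norm_triangle_ineq2[of "f t" "p N t"] by simp
      then have "(norm (f t))\<^sup>2 \<le> (norm (p N t) + 2 * e')\<^sup>2"
        by (intro power_mono) auto
      also have "\<dots> \<le> 2 * (norm (p N t))\<^sup>2 + 2 * (2 * e')\<^sup>2"
        using sum_squares_bound[of "norm (p N t)" "2 * e'"] by (simp add: power2_sum)
      finally show ?thesis
        using e'(2) by (simp add: power_mult_distrib)
    qed
    then have "integral {1/4..3/4} (\<lambda>x. (norm (f x))\<^sup>2)
        \<le> integral {1/4..3/4} (\<lambda>x. 2 * (norm (p N x))\<^sup>2 + 2 * e)"
      by (intro integral_le integrable_continuous_interval continuous_intros p_cont
          continuous_on_subset[OF f]) auto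
    also have "\<dots> = 2 * integral {1/4..3/4} (\<lambda>x. (norm (p N x))\<^sup>2) + e"
      by (subst integral_add) (auto intro!: integrable_continuous_interval continuous_intros p_cont)
    also have "integral {1/4..3/4} (\<lambda>x. (norm (p N x))\<^sup>2) \<le> integral {0..1} (\<lambda>x. (norm (p N x))\<^sup>2)"
      by (intro integral_subset_le integrable_continuous_interval continuous_intros p_cont) auto
    also have "\<dots> \<le> S"
      by (rule p_norm[OF N(2)])
    finally show ?thesis
      by simp
  qed
  show ?thesis
    by (rule field_le_epsilon) (rule approx)
qed

section \<open>Bounded semigroups and the resolvent at minus one\<close>

text \<open>Solvability of \<open>x - E x = y\<close> for a strict contraction \<open>E\<close>, by the Banach fixed-point theorem
  for \<open>x \<mapsto> y + E x\<close>.\<close>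

lemma contraction_fixpoint:
  fixes E :: "'a::banach \<Rightarrow> 'a"
  assumes E: "bounded_linear E" and q: "q < 1" "\<And>x. norm (E x) \<le> q * norm x"
  obtains x where "x - E x = y"
proof -
  interpret E: bounded_linear E by fact
  show thesis
  proof (cases "\<exists>z::'a. z \<noteq> 0")
    case True
    then obtain z :: 'a where "norm z > 0"
      by auto
    then have "0 \<le> q"
      using q(2)[of z] by (smt (verit) norm_ge_zero zero_le_mult_iff)
    then have "\<exists>!x. y + E x = x"
      using q by (intro banach_fix_type[of q]) (auto simp: dist_norm E.diff[symmetric])
    then show thesis
      using that by (metis add_diff_cancel_right')
  next
    case False
    then show thesis
      using that[of 0] E.zero by (metis diff_zero)
  qed
qed

locale bounded_C0_semigroup =
  fixes T :: "real \<Rightarrow> 'a::chilbert_space \<Rightarrow> 'a" and D :: "'a set" and A :: "'a \<Rightarrow> 'a" and M :: real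
  assumes C0: "C0_semigroup T" and gen: "is_generator T D (\<lambda>x. - A x)"
    and M: "1 \<le> M" "\<And>t x. 0 \<le> t \<Longrightarrow> norm (T t x) \<le> M * norm x"
begin

lemma bounded_linear_T: "0 \<le> t \<Longrightarrow> bounded_linear (T t)"
  using C0 by (auto simp: C0_semigroup_def bounded_clinear_def)

lemma T_scaleC: "0 \<le> t \<Longrightarrow> T t (c *\<^sub>C x) = c *\<^sub>C T t x"
  using C0 by (auto simp: C0_semigroup_def bounded_clinear_def)

lemmas T_diff = linear_diff[OF bounded_linear.linear[OF bounded_linear_T]]
  and T_add = linear_add[OF bounded_linear.linear[OF bounded_linear_T]]
  and T_minus = linear_neg[OF bounded_linear.linear[OF bounded_linear_T]]
  and T_scaleR = linear_scale[OF bounded_linear.linear[OF bounded_linear_T]]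

lemma T_zero_time [simp]: "T 0 x = x"
  using C0 by (auto simp: C0_semigroup_def)

lemma T_semigroup: "0 \<le> s \<Longrightarrow> 0 \<le> t \<Longrightarrow> T (s + t) x = T s (T t x)"
  using C0 by (auto simp: C0_semigroup_def)

lemma T_commute: "0 \<le> s \<Longrightarrow> 0 \<le> t \<Longrightarrow> T s (T t x) = T t (T s x)"
  by (metis T_semigroup add.commute)

lemma T_tendsto: "((\<lambda>t. T t x) \<longlongrightarrow> x) (at_right 0)"
  using C0 by (auto simp: C0_semigroup_def)

text \<open>Left and right increments of an orbit have the same form, with the operator for the earlier
  time in front. Since these operators are uniformly bounded, behaviour at time zero
  controls both one-sided limits at every time.\<close>

lemma T_increment:
  assumes "0 \<le> s" "0 \<le> t"
  obtains "s \<le> t" "T t x - T s x = T s (T (t - s) x - x)" | "t \<le> s" "T s x - T t x = T t (T (s - t) x - x)"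
proof (cases "s \<le> t")
  case True
  have "T t x = T s (T (t - s) x)"
    using T_semigroup[of s "t - s" x] assms True by simp
  then have "T t x - T s x = T s (T (t - s) x - x)"
    unfolding T_diff[OF assms(1)] by (rule arg_cong)
  with True show thesis
    by (rule that(1))
next
  case False
  then have "t \<le> s"
    by simp
  then have "T s x = T t (T (s - t) x)"
    using T_semigroup[of t "s - t" x] assms by simp
  then have "T s x - T t x = T t (T (s - t) x - x)"
    unfolding T_diff[OF assms(2)] by (rule arg_cong)
  with \<open>t \<le> s\<close> show thesis
    by (rule that(2))
qed

lemma continuous_on_T: "continuous_on {0..} (\<lambda>t. T t x)"
  unfolding continuous_on_iff
proof (intro ballI allI impI)
  fix t e :: real
  assume t: "t \<in> {0..}" and "e > 0"
  then have "e / M > 0"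
    using M(1) by simp
  from tendstoD[OF T_tendsto this] obtain d where d: "d > 0" "\<And>h. 0 < h \<Longrightarrow> h < d \<Longrightarrow> dist (T h x) x < e / M"
    unfolding eventually_at_right_field by auto
  have "norm (T h x - x) < e / M" if "0 \<le> h" "h < d" for h
    using d(2)[of h] that \<open>e / M > 0\<close> by (cases "h = 0") (auto simp: dist_norm)
  then have *: "norm (T r (T h x - x)) < e" if "0 \<le> h" "h < d" "0 \<le> r" for r h
    using M(2)[of r "T h x - x"] M(1) that by (smt (verit) mult.commute pos_less_divide_eq)
  show "\<exists>d>0. \<forall>s\<in>{0..}. dist s t < d \<longrightarrow> dist (T s x) (T t x) < e"
  proof (intro exI[of _ d] conjI ballI impI)
    fix s assume s: "s \<in> {0..}" "dist s t < d"
    then have "0 \<le> s" "0 \<le> t"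
      using t by simp_all
    from T_increment[OF this, of x] show "dist (T s x) (T t x) < e"
    proof cases
      case 1
      then have "norm (T t x - T s x) < e"
        using *[of "t - s" s] s by (simp add: dist_real_def)
      then show ?thesis
        by (simp add: dist_norm norm_minus_commute)
    next
      case 2
      then show ?thesis
        using *[of "s - t" t] s t by (simp add: dist_real_def dist_norm)
    qed
  qed (rule d)
qed

lemma continuous_on_T_compose [continuous_intros]:
  "continuous_on S f \<Longrightarrow> (\<And>x. x \<in> S \<Longrightarrow> 0 \<le> f x) \<Longrightarrow> continuous_on S (\<lambda>s. T (f s) x)"
  by (rule continuous_on_compose2[OF continuous_on_T[of x]]) auto

lemma generatorD: "x \<in> D \<Longrightarrow> ((\<lambda>h. (T h x - x) /\<^sub>R h) \<longlongrightarrow> - A x) (at_right 0)"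
  using gen by (auto simp: is_generator_def)

lemma generatorI:
  assumes "((\<lambda>h. (T h x - x) /\<^sub>R h) \<longlongrightarrow> - y) (at_right 0)"
  shows "x \<in> D" "A x = y"
proof -
  show D: "x \<in> D"
    using gen assms by (auto simp: is_generator_def)
  have "- A x = - y"
    by (rule tendsto_unique[OF _ generatorD[OF D] assms]) simp
  then show "A x = y"
    by simp
qed

lemma eventually_at_right_0_pos: "eventually (\<lambda>h::real. 0 \<le> h) (at_right 0)"
  by (auto simp: eventually_at_right_field intro!: exI[of _ 1])

lemma generator_add:
  assumes "x \<in> D" "y \<in> D"
  shows "x + y \<in> D" "A (x + y) = A x + A y"
proof -
  have "((\<lambda>h. (T h x - x) /\<^sub>R h + (T h y - y) /\<^sub>R h) \<longlongrightarrow> - (A x + A y)) (at_right 0)"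
    using tendsto_add[OF generatorD[OF assms(1)] generatorD[OF assms(2)]] by simp
  then have "((\<lambda>h. (T h (x + y) - (x + y)) /\<^sub>R h) \<longlongrightarrow> - (A x + A y)) (at_right 0)"
    by (rule Lim_transform_eventually)
      (rule eventually_mono[OF eventually_at_right_0_pos], simp add: T_add algebra_simps)
  from generatorI[OF this] show "x + y \<in> D" "A (x + y) = A x + A y" .
qed

lemma generator_scaleC:
  assumes "x \<in> D"
  shows "c *\<^sub>C x \<in> D" "A (c *\<^sub>C x) = c *\<^sub>C A x"
proof -
  have "((\<lambda>h. c *\<^sub>C ((T h x - x) /\<^sub>R h)) \<longlongrightarrow> - (c *\<^sub>C A x)) (at_right 0)"
    using scaleC.tendsto[OF tendsto_const generatorD[OF assms]] by (simp add: scaleC.minus_right)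
  then have "((\<lambda>h. (T h (c *\<^sub>C x) - c *\<^sub>C x) /\<^sub>R h) \<longlongrightarrow> - (c *\<^sub>C A x)) (at_right 0)"
    by (rule Lim_transform_eventually)
      (rule eventually_mono[OF eventually_at_right_0_pos],
        simp add: T_scaleC scaleC.scaleR_right scaleC.diff_right)
  from generatorI[OF this] show "c *\<^sub>C x \<in> D" "A (c *\<^sub>C x) = c *\<^sub>C A x" .
qed

lemma generator_T:
  assumes "x \<in> D" "0 \<le> t"
  shows "T t x \<in> D" "A (T t x) = T t (A x)"
proof -
  have "((\<lambda>h. T t ((T h x - x) /\<^sub>R h)) \<longlongrightarrow> - T t (A x)) (at_right 0)"
    using bounded_linear.tendsto[OF bounded_linear_T[OF assms(2)] generatorD[OF assms(1)]]
    by (simp add: T_minus assms)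
  then have "((\<lambda>h. (T h (T t x) - T t x) /\<^sub>R h) \<longlongrightarrow> - T t (A x)) (at_right 0)"
    by (rule Lim_transform_eventually)
      (rule eventually_mono[OF eventually_at_right_0_pos],
        simp add: T_scaleR T_diff assms T_commute)
  from generatorI[OF this] show "T t x \<in> D" "A (T t x) = T t (A x)" .
qed

lemma generator_diff:
  assumes "x \<in> D" "y \<in> D"
  shows "x - y \<in> D" "A (x - y) = A x - A y"
  using generator_add[OF assms(1) generator_scaleC(1)[OF assms(2), of "-1"]]
    generator_scaleC(2)[OF assms(2), of "-1"]
  by (simp_all add: scaleC.minus_left scaleC_one)

lemma has_vector_derivative_T:
  assumes "x \<in> D" "0 \<le> t"
  shows "((\<lambda>t. T t x) has_vector_derivative - T t (A x)) (at t within {0..})"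
  unfolding has_vector_derivative_def has_derivative_within_alt
proof (intro conjI allI impI)
  show "bounded_linear (\<lambda>h. h *\<^sub>R - T t (A x))"
    by (rule bounded_linear_scaleR_left)
next
  fix e :: real
  assume e: "e > 0"
  then have eM: "e / (2 * M) > 0"
    using M(1) by simp
  obtain d1 where d1: "d1 > 0" "\<And>h. 0 < h \<Longrightarrow> h < d1 \<Longrightarrow> dist ((T h x - x) /\<^sub>R h) (- A x) < e / (2 * M)"
    using tendstoD[OF generatorD[OF assms(1)] eM] unfolding eventually_at_right_field by auto
  obtain d2 where d2: "d2 > 0" "\<And>r. 0 \<le> r \<Longrightarrow> dist r t < d2 \<Longrightarrow> dist (T r (A x)) (T t (A x)) < e / 2"
    using continuous_on_T[of "A x"] e assms(2) unfolding continuous_on_iff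
    by (metis atLeast_iff half_gt_zero)
  have *: "norm (T r (T h x - x) + h *\<^sub>R T t (A x)) \<le> e * h"
    if "0 \<le> h" "h < d1" "0 \<le> r" "dist r t < d2" for r h
  proof (cases "h = 0")
    case False
    then have h: "h > 0"
      using that by simp
    have "T r (T h x - x) + h *\<^sub>R T t (A x)
      = h *\<^sub>R (T r ((T h x - x) /\<^sub>R h - - A x) + (T t (A x) - T r (A x)))"
      using h that by (simp add: T_diff T_add T_scaleR scaleR_add_right scaleR_diff_right)
    also have "norm \<dots> = h * norm (T r ((T h x - x) /\<^sub>R h - - A x) + (T t (A x) - T r (A x)))"
      using h by simp
    also have "\<dots> \<le> h * (M * (e / (2 * M)) + e / 2)"
    proof (intro mult_left_mono norm_triangle_mono)
      have "norm (T r ((T h x - x) /\<^sub>R h - - A x)) \<le> M * norm ((T h x - x) /\<^sub>R h - - A x)"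
        by (rule M(2)[OF that(3)])
      also have "\<dots> \<le> M * (e / (2 * M))"
        using d1(2)[OF h that(2)] M(1) by (intro mult_left_mono) (auto simp: dist_norm)
      finally show "norm (T r ((T h x - x) /\<^sub>R h - - A x)) \<le> M * (e / (2 * M))" .
      show "norm (T t (A x) - T r (A x)) \<le> e / 2"
        using d2(2)[OF that(3,4)] by (simp add: dist_norm norm_minus_commute)
    qed (use h in simp)
    also have "\<dots> = e * h"
      using M(1) by simp
    finally show ?thesis .
  qed (use that T_diff[of r 0 0] in simp)
  show "\<exists>d>0. \<forall>y\<in>{0..}. norm (y - t) < d \<longrightarrow>
      norm (T y x - T t x - (y - t) *\<^sub>R - T t (A x)) \<le> e * norm (y - t)"
  proof (intro exI[of _ "min d1 d2"] conjI ballI impI)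
    fix s :: real
    assume s: "s \<in> {0..}" "norm (s - t) < min d1 d2"
    from s(1) have "0 \<le> s"
      by simp
    from T_increment[OF this assms(2), of x]
    show "norm (T s x - T t x - (s - t) *\<^sub>R - T t (A x)) \<le> e * norm (s - t)"
    proof cases
      case 1
      have "T s x - T t x - (s - t) *\<^sub>R - T t (A x) = - (T s (T (t - s) x - x) + (t - s) *\<^sub>R T t (A x))"
        unfolding 1(2)[symmetric] by (simp add: algebra_simps)
      then have "norm (T s x - T t x - (s - t) *\<^sub>R - T t (A x)) = norm (T s (T (t - s) x - x) + (t - s) *\<^sub>R T t (A x))"
        by (simp only: norm_minus_cancel)
      also have "\<dots> \<le> e * norm (s - t)"
        using *[of "t - s" s] 1(1) s by (simp add: dist_real_def)
      finally show ?thesis .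
    next
      case 2
      then show ?thesis
        using *[of "s - t" t] s d2(1) assms(2) by simp
    qed
  qed (use d1(1) d2(1) in simp)
qed

text \<open>A truncated Laplace transform. The identity comes from
  \<open>T h S = exp h *\<^sub>R (F (\<tau> + h) - F h)\<close>, where \<open>F\<close> is an antiderivative of
  \<open>t \<mapsto> exp (- t) *\<^sub>R T t x\<close>: differentiate the right-hand side at \<open>h = 0\<close>. As the
  semigroup is bounded, the remainder \<open>exp (- \<tau>) *\<^sub>R T \<tau> x\<close> is small for large \<open>\<tau>\<close>.\<close>

lemma generator_exp_integral:
  fixes x \<tau>
  defines "S \<equiv> integral {0..\<tau>} (\<lambda>t. exp (- t) *\<^sub>R T t x)"
  assumes \<tau>: "0 \<le> \<tau>"
  shows "S \<in> D" "S + A S = x - exp (- \<tau>) *\<^sub>R T \<tau> x"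
proof -
  define g where "g = (\<lambda>t. exp (- t) *\<^sub>R T t x)"
  have g: "continuous_on {a..b} g" if "0 \<le> a" for a b
    unfolding g_def using that by (intro continuous_intros) auto
  define F where "F = (\<lambda>r. integral {0..r} g)"
  have F: "((\<lambda>h. F (c + h)) has_vector_derivative g (c + h)) (at h within {0..b})"
    if "0 \<le> c" "0 \<le> h" "h \<le> b" for b c h
  proof -
    have "(F has_vector_derivative g (c + h)) (at (c + h) within {0..c + b})"
      unfolding F_def by (rule integral_has_vector_derivative) (use that g in auto)
    then have "(F has_derivative (\<lambda>y. y *\<^sub>R g (c + h))) (at (c + h) within (\<lambda>h. c + h) ` {0..b})"
      unfolding has_vector_derivative_def by (rule has_derivative_subset) (use that in auto)
    moreover have "((\<lambda>h. c + h) has_derivative (\<lambda>y. y)) (at h within {0..b})"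
      by (auto intro!: derivative_eq_intros)
    ultimately show ?thesis
      unfolding has_vector_derivative_def
      using has_derivative_in_compose[of "\<lambda>h. c + h" "\<lambda>y. y" h "{0..b}" F "\<lambda>y. y *\<^sub>R g (c + h)"] by simp
  qed
  have shift: "T h S = exp h *\<^sub>R (F (\<tau> + h) - F h)" if "0 \<le> h" for h
  proof -
    have "T h S = integral {0..\<tau>} (\<lambda>t. T h (g t))"
      using integral_linear[OF _ bounded_linear_T[OF that], of g "{0..\<tau>}"]
      by (simp add: S_def g_def[symmetric] o_def integrable_continuous_interval g)
    also have "\<dots> = integral {0..\<tau>} (\<lambda>t. exp h *\<^sub>R g (t + h))"
      by (rule integral_cong)
        (use that in \<open>simp add: g_def T_scaleR T_semigroup[symmetric] exp_add[symmetric] add.commute\<close>)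
    also have "\<dots> = exp h *\<^sub>R integral {0..\<tau>} (\<lambda>t. g (t + h))"
      by simp
    also have "integral {0..\<tau>} (\<lambda>t. g (t + h)) = F (\<tau> + h) - F h"
    proof -
      have "((\<lambda>t. g (h + t)) has_integral F (h + \<tau>) - F (h + 0)) {0..\<tau>}"
        by (rule fundamental_theorem_of_calculus) (use F that \<tau> in auto)
      then show ?thesis
        by (simp add: integral_unique add.commute)
    qed
    finally show ?thesis .
  qed
  have F0: "F 0 = 0" "F \<tau> = S" "g 0 = x"
    by (simp_all add: F_def S_def g_def)
  have "((\<lambda>h. F (\<tau> + h)) has_vector_derivative g \<tau>) (at 0 within {0..1})"
    using F[of \<tau> 0 1] \<tau> by simp
  moreover have "(F has_vector_derivative g 0) (at 0 within {0..1})"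
    using F[of 0 0 1] by simp
  ultimately have "((\<lambda>h. exp h *\<^sub>R (F (\<tau> + h) - F h)) has_vector_derivative
      exp 0 *\<^sub>R (g \<tau> - g 0) + exp 0 *\<^sub>R (F (\<tau> + 0) - F 0)) (at 0 within {0..1})"
    by (intro has_vector_derivative_scaleR has_vector_derivative_diff)
      (auto intro!: derivative_eq_intros)
  then have "((\<lambda>h. exp h *\<^sub>R (F (\<tau> + h) - F h)) has_vector_derivative
      - (x - g \<tau> - S)) (at 0 within {0..1})"
    by (simp add: F0 algebra_simps)
  then have "((\<lambda>h. (1 / norm (h - 0)) *\<^sub>R (exp h *\<^sub>R (F (\<tau> + h) - F h)
      - (exp 0 *\<^sub>R (F (\<tau> + 0) - F 0) + (h - 0) *\<^sub>R - (x - g \<tau> - S)))) \<longlongrightarrow> 0) (at_right 0)"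
    unfolding has_vector_derivative_def has_derivative_within by (simp add: at_within_Icc_at_right)
  from tendsto_add[OF this tendsto_const[of "- (x - g \<tau> - S)"]]
  have "((\<lambda>h. (T h S - S) /\<^sub>R h) \<longlongrightarrow> 0 + - (x - g \<tau> - S)) (at_right 0)"
  proof (rule Lim_transform_eventually)
    have "eventually (\<lambda>h::real. 0 < h) (at_right 0)"
      by (rule eventually_at_right_less)
    then show "\<forall>\<^sub>F h in at_right 0. (1 / norm (h - 0)) *\<^sub>R (exp h *\<^sub>R (F (\<tau> + h) - F h)
        - (exp 0 *\<^sub>R (F (\<tau> + 0) - F 0) + (h - 0) *\<^sub>R - (x - g \<tau> - S))) + - (x - g \<tau> - S)
        = (T h S - S) /\<^sub>R h"
      by eventually_elim (simp add: shift F0 divide_inverse scaleR_diff_right scaleR_add_right)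
  qed
  then have "((\<lambda>h. (T h S - S) /\<^sub>R h) \<longlongrightarrow> - (x - g \<tau> - S)) (at_right 0)"
    by simp
  from generatorI[OF this] show "S \<in> D" "S + A S = x - exp (- \<tau>) *\<^sub>R T \<tau> x"
    by (simp_all add: g_def)
qed

text \<open>Integrate the derivative of \<open>t \<mapsto> exp (- t) *\<^sub>R T t x\<close>, which is
  \<open>- exp (- t) *\<^sub>R T t (x + A x)\<close>, from \<open>0\<close> to \<open>\<tau>\<close>.\<close>

lemma norm_le_norm_one_plus_A:
  assumes "x \<in> D" "0 \<le> \<tau>"
  shows "norm x \<le> \<tau> * M * norm (x + A x) + exp (- \<tau>) * M * norm x"
proof -
  have "((\<lambda>t. - (exp (- t) *\<^sub>R T t (x + A x))) has_integral (exp (- \<tau>) *\<^sub>R T \<tau> x - exp (- 0) *\<^sub>R T 0 x)) {0..\<tau>}"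
  proof (rule fundamental_theorem_of_calculus)
    fix t assume t: "t \<in> {0..\<tau>}"
    have "((\<lambda>t. T t x) has_vector_derivative - T t (A x)) (at t within {0..\<tau>})"
      using has_vector_derivative_T[OF assms(1), of t] t
      by (auto intro: has_vector_derivative_within_subset[of _ _ t "{0..}"])
    then have "((\<lambda>t. exp (- t) *\<^sub>R T t x) has_vector_derivative
      exp (- t) *\<^sub>R (- T t (A x)) + (- exp (- t)) *\<^sub>R T t x) (at t within {0..\<tau>})"
      by (intro has_vector_derivative_scaleR) (auto intro!: derivative_eq_intros)
    then show "((\<lambda>t. exp (- t) *\<^sub>R T t x) has_vector_derivative - (exp (- t) *\<^sub>R T t (x + A x))) (at t within {0..\<tau>})"
      using t by (simp add: T_add algebra_simps)
  qed (use assms in simp)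
  then have "norm (exp (- \<tau>) *\<^sub>R T \<tau> x - exp (- 0) *\<^sub>R T 0 x) \<le> M * norm (x + A x) * measure lborel {0..\<tau>}"
  proof (rule has_integral_bound_real[where S = "{}", rotated 2])
    fix t assume "t \<in> {0..\<tau>} - {}"
    then have "exp (- t) * norm (T t (x + A x)) \<le> 1 * (M * norm (x + A x))"
      by (intro mult_mono M(2)) auto
    then show "norm (- (exp (- t) *\<^sub>R T t (x + A x))) \<le> M * norm (x + A x)"
      by simp
  qed (use M(1) in simp_all)
  then have "norm (exp (- \<tau>) *\<^sub>R T \<tau> x - x) \<le> \<tau> * M * norm (x + A x)"
    using assms(2) by (simp add: mult_ac)
  moreover have "norm (exp (- \<tau>) *\<^sub>R T \<tau> x) \<le> exp (- \<tau>) * M * norm x"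
    using M(2)[OF assms(2), of x] by simp
  ultimately show ?thesis
    using norm_triangle_ineq2[of x "exp (- \<tau>) *\<^sub>R T \<tau> x"]
      norm_minus_commute[of x "exp (- \<tau>) *\<^sub>R T \<tau> x"] by linarith
qed

text \<open>The time \<open>\<tau>\<close> is chosen such that \<open>exp (- \<tau>) *\<^sub>R T \<tau>\<close> has norm at most \<open>1/2\<close>. In the
  previous estimate the last term is then absorbed by the left-hand side, and the truncated Laplace
  transform gives surjectivity because the identity minus this contraction is onto.\<close>

lemma one_plus_A_boundedly_invertible:
  obtains c where "c > 0" "\<And>x. x \<in> D \<Longrightarrow> norm x \<le> c * norm (x + A x)"
    and "\<And>y. \<exists>x\<in>D. x + A x = y"
proof -
  define \<tau> where "\<tau> = ln (2 * M)"
  have \<tau>: "\<tau> > 0" "exp (- \<tau>) * M = 1 / 2"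
    using M(1) by (simp_all add: \<tau>_def exp_minus)
  show thesis
  proof
    show "2 * \<tau> * M > 0"
      using \<tau> M by simp
    show "norm x \<le> 2 * \<tau> * M * norm (x + A x)" if "x \<in> D" for x
      using norm_le_norm_one_plus_A[OF that, of \<tau>] \<tau> by simp
    show "\<exists>x\<in>D. x + A x = y" for y
    proof -
      have "bounded_linear (\<lambda>z. exp (- \<tau>) *\<^sub>R T \<tau> z)"
        using \<tau> by (intro bounded_linear_const_scaleR bounded_linear_T) simp
      moreover have "norm (exp (- \<tau>) *\<^sub>R T \<tau> z) \<le> 1 / 2 * norm z" for z
        unfolding \<tau>(2)[symmetric] using M(2)[of \<tau> z] \<tau> by simp
      ultimately obtain z where "z - exp (- \<tau>) *\<^sub>R T \<tau> z = y"
        using contraction_fixpoint[of "\<lambda>z. exp (- \<tau>) *\<^sub>R T \<tau> z" "1 / 2" y] by auto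
      then show ?thesis
        using generator_exp_integral[of \<tau> z] \<tau> by (metis less_imp_le)
    qed
  qed
qed

text \<open>The operators \<open>J = (1 + A)\<^sup>-\<^sup>1\<close> and \<open>B = A (1 + A)\<^sup>-\<^sup>1 = 1 - J\<close> are bounded and commute with the
  semigroup. Identities for \<open>A\<close> are first proved in a form that involves only \<open>J\<close> and
  \<open>B\<close>, which pass through integrals.\<close>

definition "J = shift_inv D A 1"

lemma J_unique: "x \<in> D \<Longrightarrow> x + A x = y \<Longrightarrow> J y = x"
  and J_in_D: "J y \<in> D"
  and A_J: "A (J y) = y - J y"
  and bounded_linear_J: "bounded_linear J"
  and J_scaleC: "J (c *\<^sub>C y) = c *\<^sub>C J y"
proof -
  obtain C where C: "C > 0" "\<And>x. x \<in> D \<Longrightarrow> norm x \<le> C * norm (x + A x)"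
    and surj: "\<And>y. \<exists>x\<in>D. x + A x = y"
    using one_plus_A_boundedly_invertible by blast
  have J: "J y \<in> D \<and> J y + A (J y) = y" for y
    using surj[of y] inv_into_into[of y "\<lambda>x. 1 *\<^sub>C x + A x" D] f_inv_into_f[of y "\<lambda>x. 1 *\<^sub>C x + A x" D]
    by (auto simp: J_def shift_inv_def scaleC_one image_iff)
  show "J y \<in> D" "A (J y) = y - J y" for y
    using J[of y] by (auto simp: algebra_simps)
  have unique: "J y = x" if "x \<in> D" "x + A x = y" for x y
  proof -
    have "norm (J y - x) \<le> C * norm ((J y - x) + A (J y - x))"
      using J[of y] that generator_diff(1)[of "J y" x] by (intro C) simp
    also have "(J y - x) + A (J y - x) = 0"
      using J[of y] that by (simp add: generator_diff algebra_simps)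
    finally show ?thesis
      by simp
  qed
  then show "x \<in> D \<Longrightarrow> x + A x = y \<Longrightarrow> J y = x" for x y .
  show scale: "J (c *\<^sub>C y) = c *\<^sub>C J y" for c y
    using J[of y] by (intro unique) (simp_all add: generator_scaleC scaleC_add_right[symmetric])
  show "bounded_linear J"
  proof (rule bounded_linear_intro)
    show "J (x + y) = J x + J y" for x y
      using J[of x] J[of y] by (intro unique) (simp_all add: generator_add algebra_simps)
    show "J (r *\<^sub>R x) = r *\<^sub>R J x" for r x
      by (simp add: scaleR_scaleC scale)
    show "norm (J x) \<le> norm x * C" for x
      using C(2)[of "J x"] J[of x] by (simp add: mult.commute)
  qed
qed

lemma J_T: "0 \<le> t \<Longrightarrow> J (T t x) = T t (J x)"
  using J_in_D[of x] A_J[of x] by (intro J_unique) (simp_all add: generator_T T_diff)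

definition "B x = x - J x"

lemma bounded_linear_B: "bounded_linear B"
  unfolding B_def[abs_def] by (intro bounded_linear_sub bounded_linear_ident bounded_linear_J)

lemma B_scaleC: "B (c *\<^sub>C x) = c *\<^sub>C B x"
  by (simp add: B_def J_scaleC scaleC.diff_right)

lemma B_T: "0 \<le> t \<Longrightarrow> B (T t x) = T t (B x)"
  by (simp add: B_def J_T T_diff)

lemma J_add_B: "J x + B x = x"
  by (simp add: B_def)

end

section \<open>A polynomial cutoff\<close>

lemma power_dvd_pderiv:
  fixes p q :: "'a::idom poly"
  assumes "q ^ Suc n dvd p"
  shows "q ^ n dvd pderiv p"
proof -
  from assms obtain r where "p = q ^ Suc n * r"
    by (elim dvdE)
  then have "pderiv p = q ^ n * (q * pderiv r + r * smult (of_nat (Suc n)) (pderiv q))"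
    by (simp only: pderiv_mult pderiv_power_Suc) (simp add: algebra_simps)
  then show ?thesis
    by simp
qed

text \<open>Each derivative lowers the order of vanishing by at most one. For the cutoff
  \<open>(x (1 - x)) ^ k\<close> this makes the boundary terms of \<open>k\<close> successive integrations by parts vanish.\<close>

lemma poly_iterated_pderiv_eq_0:
  fixes q :: "'a::idom poly"
  assumes "poly q x = 0" "j < k"
  shows "poly ((pderiv ^^ j) (q ^ k)) x = 0"
proof -
  have "q ^ (k - i) dvd (pderiv ^^ i) (q ^ k)" if "i \<le> j" for i
    using that
  proof (induction i)
    case (Suc i)
    then have "Suc (k - Suc i) = k - i"
      using assms(2) by simp
    with Suc show ?case
      by (auto intro!: power_dvd_pderiv)
  qed simp
  then obtain r where "(pderiv ^^ j) (q ^ k) = q ^ (k - j) * r"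
    by blast
  then show ?thesis
    using assms by (simp add: power_0_left)
qed

section \<open>Fourier coefficients of truncated orbits\<close>

context bounded_C0_semigroup
begin

lemma has_vector_derivative_orbit_J:
  assumes "0 \<le> L" "x \<in> {0..1}"
  shows "((\<lambda>x. T (L * x) (J y)) has_vector_derivative - (L *\<^sub>R T (L * x) (B y))) (at x within {0..1})"
proof -
  have "((\<lambda>t. T t (J y)) has_vector_derivative - T (L * x) (B y)) (at (L * x) within (\<lambda>x. L * x) ` {0..1})"
    using has_vector_derivative_T[OF J_in_D, of "L * x" y] assms
    by (auto simp: A_J B_def intro!: has_vector_derivative_within_subset[of _ _ "L * x" "{0..}"])
  moreover have "((\<lambda>x. L * x) has_vector_derivative L) (at x within {0..1})"
    by (auto intro!: derivative_eq_intros)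
  ultimately show ?thesis
    using vector_diff_chain_within[of "\<lambda>x. L * x" L x "{0..1}" "\<lambda>t. T t (J y)" "- T (L * x) (B y)"]
    by (simp add: o_def)
qed

text \<open>Integration by parts: the boundary terms vanish with \<open>\<psi>\<close>. In general only orbits starting in the
  range of \<open>J\<close> are differentiable, hence the factor \<open>J\<close> on the right and \<open>B\<close>, the image of \<open>A\<close>
  under it, on the left.\<close>

lemma fourier_coeff_orbit:
  fixes \<psi> \<psi>' :: "real \<Rightarrow> real"
  assumes L: "0 \<le> L"
    and deriv: "\<And>x. x \<in> {0..1} \<Longrightarrow> (\<psi> has_vector_derivative \<psi>' x) (at x within {0..1})"
    and cont: "continuous_on {0..1} \<psi>'"
    and ends: "\<psi> 0 = 0" "\<psi> 1 = 0"
  shows "L *\<^sub>R B (fourier_coeff (\<lambda>x. \<psi> x *\<^sub>R T (L * x) y) n)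
    = J (fourier_coeff (\<lambda>x. \<psi>' x *\<^sub>R T (L * x) y) n
        - (2 * pi * n * \<i>) *\<^sub>C fourier_coeff (\<lambda>x. \<psi> x *\<^sub>R T (L * x) y) n)"
proof -
  define a where "a = fourier_coeff (\<lambda>x. \<psi> x *\<^sub>R T (L * x) y) n"
  define a' where "a' = fourier_coeff (\<lambda>x. \<psi>' x *\<^sub>R T (L * x) y) n"
  have cont0: "continuous_on {0..1} \<psi>"
    by (rule continuous_on_vector_derivative) (rule deriv)
  have orbit: "continuous_on {0..1} (\<lambda>x. T (L * x) z)" for z
    using L by (intro continuous_intros) auto
  have apply_op: "integral {0..1} (\<lambda>x. character (- n) x *\<^sub>C (\<phi> x *\<^sub>R T (L * x) (H y)))
      = H (fourier_coeff (\<lambda>x. \<phi> x *\<^sub>R T (L * x) y) n)"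
    if H: "bounded_linear H" "\<And>c x. H (c *\<^sub>C x) = c *\<^sub>C H x" "\<And>t x. 0 \<le> t \<Longrightarrow> H (T t x) = T t (H x)"
      and \<phi>: "continuous_on {0..1} \<phi>" for \<phi> :: "real \<Rightarrow> real" and H
  proof -
    have "fourier_coeff (\<lambda>x. H (\<phi> x *\<^sub>R T (L * x) y)) n
        = H (fourier_coeff (\<lambda>x. \<phi> x *\<^sub>R T (L * x) y) n)"
      by (intro fourier_coeff_bounded_linear continuous_intros orbit \<phi> H)
    moreover have "fourier_coeff (\<lambda>x. H (\<phi> x *\<^sub>R T (L * x) y)) n
        = integral {0..1} (\<lambda>x. character (- n) x *\<^sub>C (\<phi> x *\<^sub>R T (L * x) (H y)))"
      unfolding fourier_coeff_def
      by (intro integral_cong) (use L in \<open>simp add: linear_scale[OF bounded_linear.linear[OF H(1)]] H(3)\<close>)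
    ultimately show ?thesis
      by simp
  qed
  define g where "g = (\<lambda>x. character (- n) x *\<^sub>C (\<psi> x *\<^sub>R T (L * x) (J y)))"
  have "((\<lambda>x. character (- n) x *\<^sub>C (\<psi>' x *\<^sub>R T (L * x) (J y))
      - L *\<^sub>R (character (- n) x *\<^sub>C (\<psi> x *\<^sub>R T (L * x) (B y)))
      - (2 * pi * n * \<i>) *\<^sub>C (character (- n) x *\<^sub>C (\<psi> x *\<^sub>R T (L * x) (J y)))) has_integral g 1 - g 0) {0..1}"
  proof (rule fundamental_theorem_of_calculus)
    fix x :: real
    assume x: "x \<in> {0..1}"
    have "(g has_vector_derivative
        character (- n) x *\<^sub>C (\<psi> x *\<^sub>R (- (L *\<^sub>R T (L * x) (B y))) + \<psi>' x *\<^sub>R T (L * x) (J y))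
        + (2 * pi * (- n) * \<i> * character (- n) x) *\<^sub>C (\<psi> x *\<^sub>R T (L * x) (J y))) (at x within {0..1})"
      unfolding g_def
      by (intro scaleC.has_vector_derivative has_vector_derivative_character
          bounded_bilinear.has_vector_derivative[OF bounded_bilinear_scaleR] deriv x
          has_vector_derivative_orbit_J L)
    then show "(g has_vector_derivative character (- n) x *\<^sub>C (\<psi>' x *\<^sub>R T (L * x) (J y))
      - L *\<^sub>R (character (- n) x *\<^sub>C (\<psi> x *\<^sub>R T (L * x) (B y)))
      - (2 * pi * n * \<i>) *\<^sub>C (character (- n) x *\<^sub>C (\<psi> x *\<^sub>R T (L * x) (J y)))) (at x within {0..1})"
      by (simp add: scaleC.add_right scaleC.diff_right mult.commute[of L] scaleC.minus_right scaleC.minus_left scaleC.scaleR_right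
          scaleC_scaleC scaleR_left_commute)
  qed simp
  then have "integral {0..1} (\<lambda>x. character (- n) x *\<^sub>C (\<psi>' x *\<^sub>R T (L * x) (J y))
      - L *\<^sub>R (character (- n) x *\<^sub>C (\<psi> x *\<^sub>R T (L * x) (B y)))
      - (2 * pi * n * \<i>) *\<^sub>C (character (- n) x *\<^sub>C (\<psi> x *\<^sub>R T (L * x) (J y)))) = 0"
    by (simp add: g_def ends scaleC.zero_right integral_unique)
  moreover have "integral {0..1} (\<lambda>x. character (- n) x *\<^sub>C (\<psi>' x *\<^sub>R T (L * x) (J y))
      - L *\<^sub>R (character (- n) x *\<^sub>C (\<psi> x *\<^sub>R T (L * x) (B y)))
      - (2 * pi * n * \<i>) *\<^sub>C (character (- n) x *\<^sub>C (\<psi> x *\<^sub>R T (L * x) (J y))))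
     = J a' - L *\<^sub>R B a - (2 * pi * n * \<i>) *\<^sub>C J a"
  proof -
    have int: "(\<lambda>x. character (- n) x *\<^sub>C (\<phi> x *\<^sub>R T (L * x) z)) integrable_on {0..1}"
      if "continuous_on {0..1} \<phi>" for \<phi> :: "real \<Rightarrow> real" and z
      by (intro integrable_character_scaleC continuous_intros orbit that)
    have intC: "(\<lambda>x. c *\<^sub>C (character (- n) x *\<^sub>C (\<psi> x *\<^sub>R T (L * x) z))) integrable_on {0..1}" for c z
      by (intro integrable_continuous_interval continuous_intros orbit cont0)
    have "integral {0..1} (\<lambda>x. c *\<^sub>C (character (- n) x *\<^sub>C (\<psi> x *\<^sub>R T (L * x) (J y)))) = c *\<^sub>C J a" for c
      using integral_linear[OF int[OF cont0] scaleC.bounded_linear_right, of c "J y"]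
        apply_op[OF bounded_linear_J J_scaleC J_T cont0]
      by (simp add: o_def a_def)
    moreover have "integral {0..1} (\<lambda>x. character (- n) x *\<^sub>C (\<psi> x *\<^sub>R T (L * x) (B y))) = B a"
      unfolding a_def by (rule apply_op[OF bounded_linear_B B_scaleC B_T cont0])
    moreover have "integral {0..1} (\<lambda>x. character (- n) x *\<^sub>C (\<psi>' x *\<^sub>R T (L * x) (J y))) = J a'"
      unfolding a'_def by (rule apply_op[OF bounded_linear_J J_scaleC J_T cont])
    ultimately show ?thesis
      using int[OF cont] int[OF cont0] intC
      by (subst integral_diff, auto intro!: integrable_diff integrable_cmul)
        (subst integral_diff, auto intro!: integrable_cmul)
  qed
  ultimately have "L *\<^sub>R B a = J a' - (2 * pi * n * \<i>) *\<^sub>C J a"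
    by (simp add: algebra_simps)
  then show ?thesis
    unfolding a_def a'_def J_scaleC[symmetric] linear_diff[OF bounded_linear.linear[OF bounded_linear_J]] .
qed

text \<open>Removes the factor \<open>J\<close> from the preceding identity. It expresses \<open>B a\<close>, hence
  \<open>a = J a + B a\<close>, as an element of the range of \<open>J\<close>, which is the domain of \<open>A\<close>.\<close>

lemma resolvent_equation_of_J:
  assumes "L > 0" and eq: "L *\<^sub>R B a = J (b - (of_real (L * w) * \<i>) *\<^sub>C a)"
  shows "a \<in> D" "(\<i> * of_real w) *\<^sub>C a + A a = b /\<^sub>R L"
proof -
  interpret J: bounded_linear J
    by (rule bounded_linear_J)
  define z where "z = a + (b /\<^sub>R L - (\<i> * of_real w) *\<^sub>C a)"
  have "(b - (of_real (L * w) * \<i>) *\<^sub>C a) /\<^sub>R L = b /\<^sub>R L - (\<i> * of_real w) *\<^sub>C a"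
  proof -
    have "of_real (inverse L) * (of_real (L * w) * \<i>) = \<i> * of_real w"
      using assms(1) by simp
    then show ?thesis
      unfolding scaleR_scaleC[where 'a = 'a] scaleC.diff_right scaleC_scaleC by (simp only:)
  qed
  moreover have "B a = J ((b - (of_real (L * w) * \<i>) *\<^sub>C a) /\<^sub>R L)"
    using arg_cong[OF eq, of "\<lambda>v. v /\<^sub>R L"] assms(1) by (simp add: J.scaleR)
  ultimately have "B a = J (b /\<^sub>R L - (\<i> * of_real w) *\<^sub>C a)"
    by simp
  then have "J z = a"
    using J_add_B[of a] by (simp add: z_def J.add)
  then show "a \<in> D" "(\<i> * of_real w) *\<^sub>C a + A a = b /\<^sub>R L"
    using J_in_D[of z] A_J[of z] by (simp_all add: z_def)
qed

text \<open>Let \<open>a j\<close> be the Fourier coefficients of the \<open>j\<close>-th derivative of the cutoff \<open>(x (1 - x)) ^ k\<close>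
  times the orbit rescaled to \<open>[0, 1]\<close>. Frequency \<open>n\<close> belongs to the point
  \<open>\<i> w\<close> of the imaginary axis, where \<open>w = 2 \<pi> n / L\<close>, and \<open>(\<i> w + A) (a j) = a (j + 1) / L\<close> for \<open>j < k\<close>.

  If \<open>\<bar>w\<bar> \<ge> d\<close>, applying the resolvent \<open>k\<close> times bounds \<open>a 0\<close> by \<open>(K / L) ^ k\<close> times \<open>a k\<close>.
  If \<open>\<bar>w\<bar> < d\<close>, the operator \<open>B\<close> provides the smallness: \<open>B (a 0) = J (a 1 / L - \<i> w a 0)\<close> is already
  of size \<open>1 / L + d\<close>. Bessel's inequality sums the right-hand sides over all frequencies, and
  the lower bound of Parseval type turns the left-hand sides into the square mean of
  \<open>T (L x) (B y)\<close> over \<open>1/4 \<le> x \<le> 3/4\<close>, which dominates \<open>T L (B y)\<close> because the semigroup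
  is bounded.\<close>

lemma decay_estimate:
  assumes k: "k > 0"
  obtains C where "C \<ge> 0"
    and "\<And>L d K y. L > 0 \<Longrightarrow> d > 0 \<Longrightarrow> K \<ge> 0 \<Longrightarrow>
      (\<And>s x. d \<le> \<bar>s\<bar> \<Longrightarrow> x \<in> D \<Longrightarrow> norm x \<le> K * norm ((\<i> * of_real s) *\<^sub>C x + A x)) \<Longrightarrow>
      norm (T L (B y)) \<le> C * (1 / L + d + (K / L) ^ k) * norm y"
proof -
  define q where "q = [:0, 1, - 1 :: real:]"
  define p where "p = (\<lambda>j. poly ((pderiv ^^ j) (q ^ k)))"
  have p_0: "p 0 x = (x * (1 - x)) ^ k" for x
    by (simp add: p_def q_def)
  have p_deriv: "(p j has_vector_derivative p (Suc j) x) (at x within {0..1})" for j x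
    unfolding p_def has_real_derivative_iff_has_vector_derivative[symmetric]
    by (simp add: poly_DERIV[THEN has_field_derivative_at_within])
  have p_cont: "continuous_on S (p j)" for S j
    unfolding p_def by (intro continuous_intros)
  have p_ends: "p j 0 = 0" "p j 1 = 0" if "j < k" for j
    unfolding p_def using that by (auto intro!: poly_iterated_pderiv_eq_0 simp: q_def)
  have "\<exists>b\<ge>0. \<forall>x\<in>{0..1}. \<bar>p j x\<bar> \<le> b" for j
  proof -
    have "bounded (p j ` {0..1})"
      using p_cont by (intro compact_imp_bounded compact_continuous_image) auto
    then show ?thesis
      unfolding bounded_pos by (auto intro: less_imp_le)
  qed
  then obtain b where b: "\<And>j. 0 \<le> b j" "\<And>j x. x \<in> {0..1} \<Longrightarrow> \<bar>p j x\<bar> \<le> b j"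
    by metis
  \<comment> \<open>The bounds per frequency below involve the derivatives of order \<open>0\<close>, \<open>1\<close> and \<open>k\<close>.\<close>
  define Q where "Q = b 0 + b 1 + b k"
  have Q: "0 \<le> Q" "b 0 \<le> Q" "b 1 \<le> Q" "b k \<le> Q"
    using b(1)[of 0] b(1)[of 1] b(1)[of k] by (simp_all add: Q_def)
  obtain cJ cB where cJ: "\<And>x. norm (J x) \<le> norm x * cJ" and cB: "\<And>x. norm (B x) \<le> norm x * cB"
    using bounded_linear.bounded[OF bounded_linear_J] bounded_linear.bounded[OF bounded_linear_B] by blast
  define c where "c = \<bar>cJ\<bar> + \<bar>cB\<bar>"
  have c: "0 \<le> c" "norm (J x) \<le> c * norm x" "norm (B x) \<le> c * norm x" for x
  proof -
    have "norm x * cJ \<le> norm x * c" "norm x * cB \<le> norm x * c"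
      by (intro mult_left_mono; simp add: c_def)+
    then show "norm (J x) \<le> c * norm x" "norm (B x) \<le> c * norm x"
      using cJ[of x] cB[of x] by (simp_all add: mult.commute)
  qed (simp add: c_def)
  show thesis
  proof
    show "0 \<le> 6 * (16 / 3) ^ k * c * Q * M ^ 2"
      using c(1) Q(1) by simp
  next
    fix L d K :: real and y :: 'a
    assume L: "L > 0" and d: "d > 0" and K: "K \<ge> 0"
      and res: "\<And>s x. d \<le> \<bar>s\<bar> \<Longrightarrow> x \<in> D \<Longrightarrow> norm x \<le> K * norm ((\<i> * of_real s) *\<^sub>C x + A x)"
    define E where "E = 1 / L + d + (K / L) ^ k"
    have E: "0 \<le> E" "1 / L \<le> E" "d \<le> E" "(K / L) ^ k \<le> E"
      using L d K by (simp_all add: E_def)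
    define a where "a = (\<lambda>j. fourier_coeff (\<lambda>x. p j x *\<^sub>R T (L * x) y))"
    have orbit: "continuous_on {0..1} (\<lambda>x. T (L * x) z)" for z
      using L by (intro continuous_intros) auto
    have sum_a: "(\<Sum>n\<in>F. (norm (a j n))\<^sup>2) \<le> (Q * M * norm y)\<^sup>2" if "finite F" "b j \<le> Q" for F j
    proof -
      have "(\<Sum>n\<in>F. (norm (a j n))\<^sup>2) \<le> integral {0..1} (\<lambda>x. (norm (p j x *\<^sub>R T (L * x) y))\<^sup>2)"
        unfolding a_def by (intro bessel_inequality that continuous_intros p_cont orbit)
      also have "\<dots> \<le> integral {0..1} (\<lambda>x::real. (Q * M * norm y)\<^sup>2)"
      proof (intro integral_le integrable_continuous_interval continuous_intros p_cont orbit)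
        fix x :: real
        assume x: "x \<in> {0..1}"
        have "norm (p j x *\<^sub>R T (L * x) y) \<le> Q * (M * norm y)"
          unfolding norm_scaleR real_norm_def
          using b(2)[OF x, of j] that(2) Q(1) L x by (intro mult_mono M(2)) auto
        then show "(norm (p j x *\<^sub>R T (L * x) y))\<^sup>2 \<le> (Q * M * norm y)\<^sup>2"
          by (intro power_mono) (auto simp: mult.assoc)
      qed (use L in auto)
      also have "\<dots> = (Q * M * norm y)\<^sup>2"
        by simp
      finally show ?thesis .
    qed
    have rec: "a j n \<in> D \<and> (\<i> * of_real (2 * pi * n / L)) *\<^sub>C a j n + A (a j n) = a (Suc j) n /\<^sub>R L"
      if "j < k" for j n
    proof -
      have "L *\<^sub>R B (a j n) = J (a (Suc j) n - (2 * pi * n * \<i>) *\<^sub>C a j n)"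
        unfolding a_def
        by (intro fourier_coeff_orbit p_deriv p_cont p_ends that) (use L in simp)
      then show ?thesis
        using resolvent_equation_of_J[of L "a j n" "a (Suc j) n" "2 * pi * n / L"] L by simp
    qed
    have high: "norm (a 0 n) \<le> (K / L) ^ j * norm (a j n)" if n: "d \<le> \<bar>2 * pi * n / L\<bar>" and "j \<le> k" for j n
      using that(2)
    proof (induction j)
      case (Suc j)
      have "norm (a j n) \<le> K * norm (a (Suc j) n /\<^sub>R L)"
        using res[OF n, of "a j n"] rec[of j n] Suc.prems by (simp only: Suc_le_eq)
      also have "\<dots> = (K / L) * norm (a (Suc j) n)"
        using L by (simp add: divide_inverse)
      finally have "(K / L) ^ j * norm (a j n) \<le> (K / L) ^ j * ((K / L) * norm (a (Suc j) n))"
        using K L by (intro mult_left_mono) auto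
      with Suc show ?case
        by (simp add: mult_ac)
    qed simp
    have freq: "norm (B (a 0 n)) \<le> c * E * (norm (a 1 n) + norm (a 0 n) + norm (a k n))" for n
    proof (cases "d \<le> \<bar>2 * pi * n / L\<bar>")
      case True
      have "norm (B (a 0 n)) \<le> c * norm (a 0 n)"
        by (rule c)
      also have "\<dots> \<le> c * (E * norm (a k n))"
        using high[OF True order_refl] mult_right_mono[OF E(4), of "norm (a k n)"] c(1)
        by (intro mult_left_mono) auto
      also have "\<dots> = c * E * norm (a k n)"
        by simp
      also have "\<dots> \<le> c * E * (norm (a 1 n) + norm (a 0 n) + norm (a k n))"
        using c(1) E(1) by (intro mult_left_mono) auto
      finally show ?thesis .
    next
      case False
      define w where "w = 2 * pi * n / L"
      have Aa: "A (a 0 n) = a 1 n /\<^sub>R L - (\<i> * of_real w) *\<^sub>C a 0 n" and aD: "a 0 n \<in> D"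
        using rec[OF k, of n] by (simp_all add: w_def algebra_simps)
      have "J (a 0 n + A (a 0 n)) = a 0 n"
        by (rule J_unique[OF aD refl])
      then have "J (A (a 0 n)) = B (a 0 n)"
        using linear_add[OF bounded_linear.linear[OF bounded_linear_J]] J_add_B[of "a 0 n"]
        by (metis add_left_cancel)
      then have "norm (B (a 0 n)) \<le> c * norm (A (a 0 n))"
        using c(2)[of "A (a 0 n)"] by simp
      also have "\<dots> \<le> c * (E * norm (a 1 n) + E * norm (a 0 n))"
      proof (intro mult_left_mono c)
        have "norm (A (a 0 n)) \<le> (1 / L) * norm (a 1 n) + \<bar>w\<bar> * norm (a 0 n)"
          unfolding Aa using norm_triangle_ineq4[of "a 1 n /\<^sub>R L" "(\<i> * of_real w) *\<^sub>C a 0 n"] L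
          by (simp add: norm_scaleC norm_mult divide_inverse)
        also have "\<dots> \<le> E * norm (a 1 n) + E * norm (a 0 n)"
          using False E by (intro add_mono mult_right_mono) (auto simp: w_def)
        finally show "norm (A (a 0 n)) \<le> E * norm (a 1 n) + E * norm (a 0 n)" .
      qed
      also have "\<dots> = c * E * (norm (a 1 n) + norm (a 0 n))"
        by (simp add: algebra_simps)
      also have "\<dots> \<le> c * E * (norm (a 1 n) + norm (a 0 n) + norm (a k n))"
        using c(1) E(1) by (intro mult_left_mono) auto
      finally show ?thesis .
    qed
    define f where "f = (\<lambda>x. p 0 x *\<^sub>R T (L * x) (B y))"
    have f_cont: "continuous_on {0..1} f"
      unfolding f_def by (intro continuous_intros p_cont orbit)
    have f_coeff: "fourier_coeff f n = B (a 0 n)" for n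
    proof -
      have "fourier_coeff f n = fourier_coeff (\<lambda>x. B (p 0 x *\<^sub>R T (L * x) y)) n"
        unfolding fourier_coeff_def f_def
        by (intro integral_cong)
          (use L in \<open>simp add: linear_scale[OF bounded_linear.linear[OF bounded_linear_B]] B_T\<close>)
      also have "\<dots> = B (a 0 n)"
        unfolding a_def
        by (intro fourier_coeff_bounded_linear bounded_linear_B B_scaleC continuous_intros p_cont orbit)
      finally show ?thesis .
    qed
    define S where "S = (c * E)\<^sup>2 * (9 * (Q * M * norm y)\<^sup>2)"
    have "(\<Sum>n\<in>F. (norm (fourier_coeff f n))\<^sup>2) \<le> S" if F: "finite F" for F
    proof -
      have "(norm (fourier_coeff f n))\<^sup>2
          \<le> (c * E)\<^sup>2 * (3 * ((norm (a 1 n))\<^sup>2 + (norm (a 0 n))\<^sup>2 + (norm (a k n))\<^sup>2))" for n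
      proof -
        have sq: "(u + v + w)\<^sup>2 \<le> 3 * (u\<^sup>2 + v\<^sup>2 + w\<^sup>2)" for u v w :: real
          using sum_squares_bound[of u v] sum_squares_bound[of u w] sum_squares_bound[of v w]
          by (simp add: power2_sum algebra_simps)
        have "(norm (fourier_coeff f n))\<^sup>2 \<le> (c * E * (norm (a 1 n) + norm (a 0 n) + norm (a k n)))\<^sup>2"
          unfolding f_coeff by (intro power_mono freq) auto
        also have "\<dots> \<le> (c * E)\<^sup>2 * (3 * ((norm (a 1 n))\<^sup>2 + (norm (a 0 n))\<^sup>2 + (norm (a k n))\<^sup>2))"
          unfolding power_mult_distrib[of "c * E"] by (intro mult_left_mono sq) auto
        finally show ?thesis .
      qed
      then have "(\<Sum>n\<in>F. (norm (fourier_coeff f n))\<^sup>2)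
          \<le> (\<Sum>n\<in>F. (c * E)\<^sup>2 * (3 * ((norm (a 1 n))\<^sup>2 + (norm (a 0 n))\<^sup>2 + (norm (a k n))\<^sup>2)))"
        by (rule sum_mono)
      also have "\<dots> = (c * E)\<^sup>2 * (3 * ((\<Sum>n\<in>F. (norm (a 1 n))\<^sup>2) + (\<Sum>n\<in>F. (norm (a 0 n))\<^sup>2) + (\<Sum>n\<in>F. (norm (a k n))\<^sup>2)))"
        by (simp add: sum_distrib_left sum.distrib distrib_left)
      also have "\<dots> \<le> S"
        unfolding S_def using sum_a[OF F Q(2)] sum_a[OF F Q(3)] sum_a[OF F Q(4)]
        by (intro mult_left_mono) auto
      finally show ?thesis .
    qed
    then have "integral {1/4..3/4} (\<lambda>x. (norm (f x))\<^sup>2) \<le> 2 * S"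
      by (rule parseval_lower_bound[OF f_cont])
    moreover define r where "r = (3 / 16) ^ k * norm (T L (B y)) / M"
    have "integral {1/4..3/4} (\<lambda>x::real. r\<^sup>2) \<le> integral {1/4..3/4} (\<lambda>x. (norm (f x))\<^sup>2)"
    proof (intro integral_le integrable_continuous_interval continuous_intros continuous_on_subset[OF f_cont])
      fix x :: real
      assume x: "x \<in> {1/4..3/4}"
      \<comment> \<open>The minimum of \<open>x (1 - x)\<close> on \<open>[1/4, 3/4]\<close> is attained at both ends.\<close>
      have "(x - 1/4) * (3/4 - x) \<ge> 0"
        using x by (intro mult_nonneg_nonneg) auto
      then have "3 / 16 \<le> x * (1 - x)"
        by (simp add: field_simps)
      then have *: "(3 / 16) ^ k \<le> p 0 x"
        unfolding p_0 by (intro power_mono) auto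
      have Lx: "0 \<le> L * x" "0 \<le> L - L * x"
        using L x by (auto simp: mult_le_cancel_left1)
      have "T L (B y) = T (L - L * x) (T (L * x) (B y))"
        using T_semigroup[OF Lx(2,1)] by simp
      then have "norm (T L (B y)) \<le> M * norm (T (L * x) (B y))"
        using M(2)[OF Lx(2)] by simp
      then have "norm (T L (B y)) / M \<le> norm (T (L * x) (B y))"
        using M(1) by (simp add: divide_le_eq mult.commute)
      then have "(3 / 16) ^ k * (norm (T L (B y)) / M) \<le> p 0 x * norm (T (L * x) (B y))"
        using * M(1) by (intro mult_mono) (auto intro: order_trans[rotated])
      then have "r \<le> norm (f x)"
        by (auto simp: r_def f_def intro: order_trans[OF _ mult_right_mono])
      then show "r\<^sup>2 \<le> (norm (f x))\<^sup>2"
        using M(1) by (intro power_mono) (auto simp: r_def)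
    qed auto
    ultimately have "r\<^sup>2 \<le> 4 * S"
      by simp
    also have "\<dots> = (6 * (c * E * (Q * M * norm y)))\<^sup>2"
      by (simp add: S_def power_mult_distrib)
    finally have "r \<le> 6 * (c * E * (Q * M * norm y))"
      using c(1) E(1) Q(1) M(1) by (elim power2_le_imp_le) auto
    then have "M * (16 / 3) ^ k * r \<le> M * (16 / 3) ^ k * (6 * (c * E * (Q * M * norm y)))"
      using M(1) by (intro mult_left_mono) auto
    moreover have "M * (16 / 3) ^ k * r = norm (T L (B y))"
      using M(1) by (simp add: r_def power_divide)
    ultimately show "norm (T L (B y)) \<le> 6 * (16 / 3) ^ k * c * Q * M ^ 2 * (1 / L + d + (K / L) ^ k) * norm y"
      unfolding E_def[symmetric] by (simp add: mult_ac power2_eq_square)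
  qed
qed


section \<open>The resolvent on the imaginary axis\<close>

lemma resolvent_in_complement_of_spectrum:
  assumes "- w \<notin> spectrum D A"
  shows shift_inv_in_D: "shift_inv D A w y \<in> D"
    and shift_inv_solves: "w *\<^sub>C shift_inv D A w y + A (shift_inv D A w y) = y"
    and shift_inv_unique: "x \<in> D \<Longrightarrow> w *\<^sub>C x + A x = y \<Longrightarrow> shift_inv D A w y = x"
    and bounded_linear_shift_inv: "bounded_linear (shift_inv D A w)"
proof -
  define g where "g = (\<lambda>x. w *\<^sub>C x + A x)"
  define g' where "g' = (\<lambda>x. (- w) *\<^sub>C x - A x)"
  have g': "bij_betw g' D UNIV" "bounded_linear (inv_into D g')"
    using assms by (auto simp: spectrum_def g'_def)
  have neg: "g x = - g' x" for x
    by (simp add: g_def g'_def scaleC.minus_left)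
  have "inj_on g D"
    using bij_betw_imp_inj_on[OF g'(1)] by (auto simp: inj_on_def neg)
  have surj: "y \<in> g ` D" for y
  proof -
    have "- y \<in> g' ` D"
      using bij_betw_imp_surj_on[OF g'(1)] by simp
    then obtain x where "x \<in> D" "- y = g' x"
      by auto
    then show ?thesis
      using neg[of x] by (metis add.inverse_inverse image_eqI)
  qed
  have R: "shift_inv D A w = inv_into D g"
    by (simp add: shift_inv_def g_def[abs_def])
  show in_D: "shift_inv D A w y \<in> D" for y
    unfolding R by (rule inv_into_into[OF surj])
  show solves: "w *\<^sub>C shift_inv D A w y + A (shift_inv D A w y) = y" for y
    unfolding R using f_inv_into_f[OF surj[of y]] by (simp add: g_def)
  show unique: "shift_inv D A w y = x" if "x \<in> D" "w *\<^sub>C x + A x = y" for x y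
    unfolding R using inv_into_f_f[OF \<open>inj_on g D\<close> that(1)] that(2) by (simp add: g_def)
  have "shift_inv D A w = (\<lambda>y. inv_into D g' (- y))"
  proof
    fix y
    have "g' (shift_inv D A w y) = - y"
      using solves[of y] neg[of "shift_inv D A w y"] by (simp add: g_def) (metis add.inverse_inverse)
    then show "shift_inv D A w y = inv_into D g' (- y)"
      using inv_into_f_f[OF bij_betw_imp_inj_on[OF g'(1)] in_D[of y]] by simp
  qed
  then show "bounded_linear (shift_inv D A w)"
    using bounded_linear_compose[OF g'(2) bounded_linear_minus[OF bounded_linear_ident]] by simp
qed

lemma norm_le_onorm_shift_inv:
  assumes "- w \<notin> spectrum D A" "x \<in> D"
  shows "norm x \<le> onorm (shift_inv D A w) * norm (w *\<^sub>C x + A x)"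
  using onorm[OF bounded_linear_shift_inv[OF assms(1)], of "w *\<^sub>C x + A x"]
    shift_inv_unique[OF assms(1,2) refl] by simp

lemma onorm_shift_inv_nonneg: "- w \<notin> spectrum D A \<Longrightarrow> 0 \<le> onorm (shift_inv D A w)"
  by (intro onorm_pos_le bounded_linear_shift_inv)

text \<open>A bound at one point persists, up to a factor \<open>2\<close>, on a ball whose radius depends only on that
  bound; finitely many such balls cover \<open>S\<close>.\<close>

lemma resolvent_bounded_on_compact:
  assumes S: "compact S" "\<And>s. s \<in> S \<Longrightarrow> - (\<i> * of_real s) \<notin> spectrum D A"
  obtains K where "K \<ge> 0"
    "\<And>s x. s \<in> S \<Longrightarrow> x \<in> D \<Longrightarrow> norm x \<le> K * norm ((\<i> * of_real s) *\<^sub>C x + A x)"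
proof -
  define k where "k = (\<lambda>s::real. onorm (shift_inv D A (\<i> * of_real s)))"
  have k: "0 \<le> k s" if "s \<in> S" for s
    unfolding k_def by (rule onorm_shift_inv_nonneg[OF S(2)[OF that]])
  define U where "U = (\<lambda>s. ball s (1 / (2 * (k s + 1))))"
  have "s \<in> U s" if "s \<in> S" for s
    using k[OF that] by (simp add: U_def)
  then have "\<forall>s\<in>S. open (U s)" "S \<subseteq> (\<Union>s\<in>S. U s)"
    by (auto simp: U_def)
  then obtain S' where S': "S' \<subseteq> S" "finite S'" "S \<subseteq> (\<Union>s\<in>S'. U s)"
    using compactE_image[OF S(1), of S U] by blast
  show thesis
  proof
    show "0 \<le> (\<Sum>s\<in>S'. 2 * k s)"
      using S' k by (intro sum_nonneg) auto
    fix s :: real and x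
    assume s: "s \<in> S" and x: "x \<in> D"
    obtain s' where s': "s' \<in> S'" "s \<in> U s'"
      using S' s by blast
    then have k': "0 \<le> k s'" and S'': "s' \<in> S"
      using S' k by auto
    have close: "k s' * \<bar>s' - s\<bar> \<le> 1 / 2"
    proof -
      have "(k s' + 1) * \<bar>s' - s\<bar> \<le> (k s' + 1) * (1 / (2 * (k s' + 1)))"
        using s'(2) k' by (intro mult_left_mono) (auto simp: U_def dist_real_def)
      also have "\<dots> = 1 / 2"
        using k' by simp
      finally have "k s' * \<bar>s' - s\<bar> + \<bar>s' - s\<bar> \<le> 1 / 2"
        by (simp only: distrib_right mult_1)
      then show ?thesis
        by linarith
    qed
    have "norm x \<le> k s' * norm ((\<i> * of_real s') *\<^sub>C x + A x)"
      unfolding k_def by (rule norm_le_onorm_shift_inv[OF S(2)[OF S''] x])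
    also have "(\<i> * of_real s') *\<^sub>C x + A x
        = ((\<i> * of_real s) *\<^sub>C x + A x) + (\<i> * of_real (s' - s)) *\<^sub>C x"
      by (simp add: scaleC_add_left[symmetric] algebra_simps)
    also have "k s' * norm \<dots>
        \<le> k s' * (norm ((\<i> * of_real s) *\<^sub>C x + A x) + norm ((\<i> * of_real (s' - s)) *\<^sub>C x))"
      by (intro mult_left_mono norm_triangle_ineq k')
    also have "\<dots> = k s' * norm ((\<i> * of_real s) *\<^sub>C x + A x) + k s' * \<bar>s' - s\<bar> * norm x"
      by (simp only: norm_scaleC norm_mult norm_ii norm_of_real real_norm_def) (simp add: algebra_simps)
    also have "\<dots> \<le> k s' * norm ((\<i> * of_real s) *\<^sub>C x + A x) + 1 / 2 * norm x"
      using close by (intro add_left_mono mult_right_mono) auto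
    finally have "norm x \<le> 2 * k s' * norm ((\<i> * of_real s) *\<^sub>C x + A x)"
      by simp
    also have "\<dots> \<le> (\<Sum>s\<in>S'. 2 * k s) * norm ((\<i> * of_real s) *\<^sub>C x + A x)"
      using S' k s'(1) by (intro mult_right_mono member_le_sum) auto
    finally show "norm x \<le> (\<Sum>s\<in>S'. 2 * k s) * norm ((\<i> * of_real s) *\<^sub>C x + A x)" .
  qed
qed

text \<open>Otherwise \<open>A = (1 - \<i> s (\<i> s + A)\<^sup>-\<^sup>1) (\<i> s + A)\<close> would be a product of boundedly invertible
  operators.\<close>

lemma resolvent_lower_bound:
  assumes zero: "0 \<in> spectrum D A" and s: "- (\<i> * of_real s) \<notin> spectrum D A"
  shows "1 \<le> \<bar>s\<bar> * onorm (shift_inv D A (\<i> * of_real s))"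
proof (rule ccontr)
  define R where "R = shift_inv D A (\<i> * of_real s)"
  define \<rho> where "\<rho> = \<bar>s\<bar> * onorm R"
  assume "\<not> 1 \<le> \<bar>s\<bar> * onorm (shift_inv D A (\<i> * of_real s))"
  then have \<rho>: "\<rho> < 1"
    by (simp add: \<rho>_def R_def)
  note R = shift_inv_in_D[OF s, folded R_def] shift_inv_solves[OF s, folded R_def]
    bounded_linear_shift_inv[OF s, folded R_def]
  define E where "E = (\<lambda>x. (\<i> * of_real s) *\<^sub>C R x)"
  have E: "bounded_linear E"
    unfolding E_def by (rule bounded_linear_compose[OF scaleC.bounded_linear_right R(3)])
  have E_bound: "norm (E x) \<le> \<rho> * norm x" for x
    using mult_left_mono[OF onorm[OF R(3), of x], of "\<bar>s\<bar>"]
    by (simp add: E_def \<rho>_def norm_scaleC norm_mult mult.assoc)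
  have lower: "(1 - \<rho>) * norm x \<le> onorm R * norm (A x)" if "x \<in> D" for x
  proof -
    have "norm x \<le> onorm R * norm ((\<i> * of_real s) *\<^sub>C x + A x)"
      unfolding R_def by (rule norm_le_onorm_shift_inv[OF s that])
    also have "\<dots> \<le> onorm R * (\<bar>s\<bar> * norm x + norm (A x))"
      using norm_triangle_ineq[of "(\<i> * of_real s) *\<^sub>C x" "A x"] onorm_pos_le[OF R(3)]
      by (intro mult_left_mono) (auto simp: norm_scaleC norm_mult)
    finally show ?thesis
      by (simp add: \<rho>_def algebra_simps)
  qed
  define g where "g = (\<lambda>x. 0 *\<^sub>C x - A x)"
  have g: "g x = - A x" for x
    by (simp add: g_def scaleC.zero_left)
  have inj: "inj_on g D"
  proof (rule inj_onI)
    fix x x' assume x: "x \<in> D" "x' \<in> D" "g x = g x'"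
    then have "A (x - x') = 0"
      by (simp add: generator_diff g)
    then have "(1 - \<rho>) * norm (x - x') \<le> 0"
      using lower[OF generator_diff(1)[OF x(1,2)]] by simp
    then show "x = x'"
      using \<rho> by (simp add: mult_le_0_iff)
  qed
  have surj: "y \<in> g ` D" for y
  proof -
    obtain w where w: "w - E w = - y"
      using contraction_fixpoint[OF E \<rho> E_bound] by blast
    have "E w + A (R w) = w"
      using R(2)[of w] by (simp add: E_def)
    then have "A (R w) = w - E w"
      by (metis add_diff_cancel_left')
    then have "A (R w) = - y"
      by (simp only: w)
    then have "g (R w) = y"
      by (simp add: g)
    then show ?thesis
      using R(1)[of w] by blast
  qed
  define h where "h = inv_into D g"
  have h: "h y \<in> D" "g (h y) = y" for y
    using inv_into_into[OF surj[of y]] f_inv_into_f[OF surj[of y]] by (simp_all add: h_def)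
  have h_unique: "h y = x" if "x \<in> D" "g x = y" for x y
    using inv_into_f_f[OF inj that(1)] that(2) by (simp add: h_def)
  have "bounded_linear h"
  proof (rule bounded_linear_intro)
    show "h (x + y) = h x + h y" for x y
      using h[of x] h[of y] by (intro h_unique) (auto simp: generator_add g)
    show "h (r *\<^sub>R x) = r *\<^sub>R h x" for r x
      using h[of x]
      by (intro h_unique) (auto simp: scaleR_scaleC generator_scaleC g scaleC.minus_right[symmetric])
    show "norm (h x) \<le> norm x * (onorm R / (1 - \<rho>))" for x
    proof -
      have "A (h x) = - x"
        using h(2)[of x] by (simp add: g minus_equation_iff)
      then have "(1 - \<rho>) * norm (h x) \<le> onorm R * norm x"
        using lower[OF h(1)[of x]] by simp
      then show ?thesis
        using \<rho> by (simp add: field_simps)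
    qed
  qed
  moreover have "bij_betw g D UNIV"
    using inj surj by (auto simp: bij_betw_def)
  ultimately have "0 \<notin> spectrum D A"
    by (simp add: spectrum_def h_def g_def[abs_def])
  then show False
    using zero by simp
qed

end


section \<open>Decay of the semigroup\<close>

theorem theorem6p15:
  fixes T :: "real \<Rightarrow> 'a::chilbert_space \<Rightarrow> 'a"
    and D :: "'a set" and A :: "'a \<Rightarrow> 'a" and \<eta> :: real
  assumes "C0_semigroup T"
    and "bounded_semigroup T"
    and "is_generator T D (\<lambda>x. - A x)"
    and "spectrum D A \<inter> {z. Re z = 0} = {0}"
    and "\<eta> > 0"
    and "bdd_above ((\<lambda>s::real. onorm (shift_inv D A (\<i> * of_real s))) ` {s. \<bar>s\<bar> \<ge> \<eta>})"
  shows "((\<lambda>t. onorm (\<lambda>x. T t (A (shift_inv D A 1 x)))) \<longlongrightarrow> 0) at_top \<and>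
    (\<forall>(m :: real \<Rightarrow> real) (minv :: real \<Rightarrow> real) (\<epsilon> :: real).
      m ` {0<..<1} \<subseteq> {1<..} \<longrightarrow>
      continuous_on {0<..<1} m \<longrightarrow>
      antimono_on {0<..<1} m \<longrightarrow>
      (\<lambda>s. onorm (shift_inv D A (\<i> * of_real s))) \<in> O[at 0](\<lambda>s. m \<bar>s\<bar>) \<longrightarrow>
      right_inverse_at_top m minv \<longrightarrow>
      0 < \<epsilon> \<longrightarrow> \<epsilon> < 1 \<longrightarrow>
      (\<lambda>t. onorm (\<lambda>x. T t (A (shift_inv D A 1 x)))) \<in> O[at_top](\<lambda>t. minv (t powr (1 - \<epsilon>))))"
proof -
  obtain M where M: "\<And>t. 0 \<le> t \<Longrightarrow> onorm (T t) \<le> M"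
    using assms(2) by (auto simp: bounded_semigroup_def)
  interpret bounded_C0_semigroup T D A "max 1 M"
  proof
    fix t :: real and x :: 'a
    assume t: "0 \<le> t"
    then have "norm (T t x) \<le> onorm (T t) * norm x"
      using assms(1) by (intro onorm) (auto simp: C0_semigroup_def bounded_clinear_def)
    also have "\<dots> \<le> max 1 M * norm x"
      using M[OF t] by (intro mult_right_mono) auto
    finally show "norm (T t x) \<le> max 1 M * norm x" .
  qed (use assms in auto)
  define F where "F = (\<lambda>t. onorm (\<lambda>x. T t (A (shift_inv D A 1 x))))"
  have F_eq: "F t = onorm (\<lambda>x. T t (B x))" for t
    by (simp add: F_def J_def[symmetric] A_J B_def)
  have F_nonneg: "0 \<le> F t" if "0 \<le> t" for t
    unfolding F_eq using that
    by (intro onorm_pos_le bounded_linear_compose[OF bounded_linear_T bounded_linear_B])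
  have F_le: "F t \<le> b" if "0 \<le> b" "\<And>x. norm (T t (B x)) \<le> b * norm x" for t b
    unfolding F_eq using that by (intro onorm_bound)
  have zero: "0 \<in> spectrum D A"
    using assms(4) by auto
  have rho: "- (\<i> * of_real s) \<notin> spectrum D A" if "s \<noteq> 0" for s :: real
  proof
    assume "- (\<i> * of_real s) \<in> spectrum D A"
    then have "- (\<i> * of_real s) \<in> spectrum D A \<inter> {z. Re z = 0}"
      by simp
    then show False
      using assms(4) that by simp
  qed
  have bounded_away: "\<exists>K\<ge>0. \<forall>s x. r \<le> \<bar>s\<bar> \<longrightarrow> x \<in> D \<longrightarrow>
      norm x \<le> K * norm ((\<i> * of_real s) *\<^sub>C x + A x)" if r: "r > 0" for r
  proof -
    obtain K1 where K1: "\<And>s. \<eta> \<le> \<bar>s\<bar> \<Longrightarrow> onorm (shift_inv D A (\<i> * of_real s)) \<le> K1"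
      using assms(6) unfolding bdd_above_def by auto
    have "compact ({- \<eta> .. - r} \<union> {r .. \<eta>})"
      by (intro compact_Un compact_Icc)
    moreover have "- (\<i> * of_real s) \<notin> spectrum D A" if "s \<in> {- \<eta> .. - r} \<union> {r .. \<eta>}" for s
      using that r by (intro rho) auto
    ultimately obtain K2 where K2: "K2 \<ge> 0" "\<And>s x. s \<in> {- \<eta> .. - r} \<union> {r .. \<eta>} \<Longrightarrow> x \<in> D \<Longrightarrow>
        norm x \<le> K2 * norm ((\<i> * of_real s) *\<^sub>C x + A x)"
      using resolvent_bounded_on_compact by blast
    show ?thesis
    proof (intro exI[of _ "\<bar>K1\<bar> + K2"] conjI allI impI)
      fix s :: real and x
      assume s: "r \<le> \<bar>s\<bar>" and x: "x \<in> D"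
      define N where "N = norm ((\<i> * of_real s) *\<^sub>C x + A x)"
      have "norm x \<le> K1 * N \<or> norm x \<le> K2 * N"
      proof (cases "\<eta> \<le> \<bar>s\<bar>")
        case True
        have "norm x \<le> onorm (shift_inv D A (\<i> * of_real s)) * N"
          unfolding N_def using s r by (intro norm_le_onorm_shift_inv rho x) auto
        also have "\<dots> \<le> K1 * N"
          using K1[OF True] by (intro mult_right_mono) (auto simp: N_def)
        finally show ?thesis ..
      next
        case False
        then show ?thesis
          using K2(2)[OF _ x, of s] s by (auto simp: N_def abs_if split: if_splits)
      qed
      moreover have "K1 * N \<le> (\<bar>K1\<bar> + K2) * N" "K2 * N \<le> (\<bar>K1\<bar> + K2) * N"
        using K2(1) by (intro mult_right_mono; simp add: N_def)+
      ultimately show "norm x \<le> (\<bar>K1\<bar> + K2) * norm ((\<i> * of_real s) *\<^sub>C x + A x)"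
        unfolding N_def by linarith
    qed (use K2(1) in simp)
  qed
  have "(F \<longlongrightarrow> 0) at_top"
  proof -
    obtain C where C: "C \<ge> 0" "\<And>L d K y. L > 0 \<Longrightarrow> d > 0 \<Longrightarrow> K \<ge> 0 \<Longrightarrow>
      (\<And>s x. d \<le> \<bar>s\<bar> \<Longrightarrow> x \<in> D \<Longrightarrow> norm x \<le> K * norm ((\<i> * of_real s) *\<^sub>C x + A x)) \<Longrightarrow>
      norm (T L (B y)) \<le> C * (1 / L + d + (K / L) ^ 1) * norm y"
      using decay_estimate[of 1] by auto
    show ?thesis
    proof (rule order_tendstoI)
      fix e :: real
      assume "e < 0"
      then show "eventually (\<lambda>t. e < F t) at_top"
        using F_nonneg by (intro eventually_at_top_linorderI[of 0]) (auto intro: less_le_trans)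
    next
      fix e :: real
      assume e: "0 < e"
      define d where "d = e / (2 * (C + 1))"
      have d: "d > 0" "C * d < e"
        using e C(1) by (simp_all add: d_def field_simps add_nonneg_pos)
      obtain K where K: "K \<ge> 0" "\<And>s x. d \<le> \<bar>s\<bar> \<Longrightarrow> x \<in> D \<Longrightarrow>
          norm x \<le> K * norm ((\<i> * of_real s) *\<^sub>C x + A x)"
        using bounded_away[OF d(1)] by blast
      have "((\<lambda>t. C * (1 / t + d + K / t)) \<longlongrightarrow> C * (0 + d + 0)) at_top"
        by (intro tendsto_intros tendsto_divide_0[OF tendsto_const] filterlim_at_top_imp_at_infinity filterlim_ident)
      then have "eventually (\<lambda>t. C * (1 / t + d + K / t) < e) at_top"
        by (rule order_tendstoD) (use d in simp)
      with eventually_gt_at_top[of 0] show "eventually (\<lambda>t. F t < e) at_top"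
      proof eventually_elim
        case (elim t)
        have "F t \<le> C * (1 / t + d + K / t)"
          using C(2)[OF elim(1) d(1) K] by (intro F_le) (use C(1) K(1) d(1) elim in auto)
        with elim show ?case
          by simp
      qed
    qed
  qed
  moreover have "F \<in> O[at_top](\<lambda>t. minv (t powr (1 - \<epsilon>)))"
    if m1: "m ` {0<..<1} \<subseteq> {1<..}" and anti: "antimono_on {0<..<1} m"
      and bigo: "(\<lambda>s. onorm (shift_inv D A (\<i> * of_real s))) \<in> O[at 0](\<lambda>s. m \<bar>s\<bar>)"
      and inv: "right_inverse_at_top m minv" and \<epsilon>: "0 < \<epsilon>" "\<epsilon> < 1"
    for m minv :: "real \<Rightarrow> real" and \<epsilon> :: real
  proof -
    have m_gt1: "1 < m s" if "0 < s" "s < 1" for s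
      using m1 that by (auto simp: image_subset_iff)
    have m_anti: "m s' \<le> m s" if "0 < s" "s \<le> s'" "s' < 1" for s s'
      using anti that by (auto simp: monotone_on_def)
    obtain c where c: "c > 0"
      "eventually (\<lambda>s::real. norm (onorm (shift_inv D A (\<i> * of_real s))) \<le> c * norm (m \<bar>s\<bar>)) (at 0)"
      using landau_o.bigE[OF bigo] by blast
    then obtain r0 where r0: "r0 > 0" "\<And>s::real. s \<noteq> 0 \<Longrightarrow> \<bar>s\<bar> < r0 \<Longrightarrow>
        norm (onorm (shift_inv D A (\<i> * of_real s))) \<le> c * norm (m \<bar>s\<bar>)"
      unfolding eventually_at by (auto simp: dist_real_def)
    define r where "r = min r0 1 / 2"
    have r: "0 < r" "r < r0" "r < 1"
      using r0(1) by (auto simp: r_def)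
    have near: "onorm (shift_inv D A (\<i> * of_real s)) \<le> c * m \<bar>s\<bar>" if "s \<noteq> 0" "\<bar>s\<bar> \<le> r" for s :: real
      using r0(2)[OF that(1)] that m_gt1[of "\<bar>s\<bar>"] r by simp
    obtain K0 where K0: "K0 \<ge> 0" "\<And>s x. r \<le> \<bar>s\<bar> \<Longrightarrow> x \<in> D \<Longrightarrow>
        norm x \<le> K0 * norm ((\<i> * of_real s) *\<^sub>C x + A x)"
      using bounded_away[OF r(1)] by blast
    \<comment> \<open>As \<open>m > 1\<close>, the constant bound \<open>K0\<close> valid far from zero can be absorbed into \<open>m d\<close>.\<close>
    have away: "norm x \<le> (c + K0) * m d * norm ((\<i> * of_real s) *\<^sub>C x + A x)"
      if d: "0 < d" "d \<le> r" and s: "d \<le> \<bar>s\<bar>" and x: "x \<in> D" for d s x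
    proof -
      define N where "N = norm ((\<i> * of_real s) *\<^sub>C x + A x)"
      have md: "1 < m d"
        using d r by (intro m_gt1) auto
      have "norm x \<le> c * m d * N \<or> norm x \<le> K0 * 1 * N"
      proof (cases "r \<le> \<bar>s\<bar>")
        case True
        then show ?thesis
          using K0(2)[OF True x] by (simp add: N_def)
      next
        case False
        have "norm x \<le> onorm (shift_inv D A (\<i> * of_real s)) * N"
          unfolding N_def using s d by (intro norm_le_onorm_shift_inv rho x) auto
        also have "\<dots> \<le> c * m \<bar>s\<bar> * N"
          using False s d by (intro mult_right_mono near) (auto simp: N_def)
        also have "\<dots> \<le> c * m d * N"
          using False s d r c(1) by (intro mult_right_mono mult_left_mono m_anti) (auto simp: N_def)
        finally show ?thesis ..
      qed
      moreover have "c * m d * N \<le> (c + K0) * m d * N" "K0 * 1 * N \<le> (c + K0) * m d * N"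
        using K0(1) c(1) md by (intro mult_right_mono mult_mono; simp add: N_def)+
      ultimately show ?thesis
        unfolding N_def by linarith
    qed
    \<comment> \<open>With \<open>m d = t powr (1 - \<epsilon>)\<close> the high frequencies contribute a multiple of \<open>t powr (- k * \<epsilon>)\<close>,
      and for \<open>k \<ge> 1 / \<epsilon>\<close> this is at most \<open>1 / t\<close>.\<close>
    obtain k :: nat where k: "1 / \<epsilon> < real k"
      using reals_Archimedean2 by blast
    then have k_pos: "k > 0" and k\<epsilon>: "1 \<le> real k * \<epsilon>"
      using \<epsilon>(1) by (auto simp: field_simps intro: gr0I)
    obtain C where C: "C \<ge> 0" "\<And>L d K y. L > 0 \<Longrightarrow> d > 0 \<Longrightarrow> K \<ge> 0 \<Longrightarrow>
      (\<And>s x. d \<le> \<bar>s\<bar> \<Longrightarrow> x \<in> D \<Longrightarrow> norm x \<le> K * norm ((\<i> * of_real s) *\<^sub>C x + A x)) \<Longrightarrow>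
      norm (T L (B y)) \<le> C * (1 / L + d + (K / L) ^ k) * norm y"
      using decay_estimate[OF k_pos] by blast
    define C' where "C' = C * (c + 1 + (c + K0) ^ k * c)"
    have lim: "filterlim (\<lambda>t. t powr (1 - \<epsilon>)) at_top at_top"
      unfolding filterlim_at_top
    proof
      fix Z :: real
      show "eventually (\<lambda>t. Z \<le> t powr (1 - \<epsilon>)) at_top"
        using eventually_ge_at_top[of "max 1 Z powr (1 / (1 - \<epsilon>))"]
      proof eventually_elim
        case (elim t)
        have "Z \<le> (max 1 Z powr (1 / (1 - \<epsilon>))) powr (1 - \<epsilon>)"
          using \<epsilon>(2) by (simp add: powr_powr)
        also have "\<dots> \<le> t powr (1 - \<epsilon>)"
          using elim \<epsilon>(2) by (intro powr_mono2) auto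
        finally show ?case .
      qed
    qed
    have "eventually (\<lambda>t. minv (t powr (1 - \<epsilon>)) \<in> {0<..<1} \<and> m (minv (t powr (1 - \<epsilon>))) = t powr (1 - \<epsilon>)) at_top"
      using inv unfolding right_inverse_at_top_def by (rule eventually_compose_filterlim[OF _ lim])
    moreover have "eventually (\<lambda>t. m r < t powr (1 - \<epsilon>)) at_top"
      using lim unfolding filterlim_at_top_dense by blast
    ultimately have "eventually (\<lambda>t. norm (F t) \<le> C' * norm (minv (t powr (1 - \<epsilon>)))) at_top"
      using eventually_ge_at_top[of 1]
    proof eventually_elim
      case (elim t)
      define d where "d = minv (t powr (1 - \<epsilon>))"
      have d: "0 < d" "d < 1" and md: "m d = t powr (1 - \<epsilon>)"
        using elim(1) by (simp_all add: d_def)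
      \<comment> \<open>The function \<open>m\<close> is at most \<open>m r\<close> to the right of \<open>r\<close>, so large values force \<open>d\<close> below \<open>r\<close>.\<close>
      have dr: "d \<le> r"
      proof (rule ccontr)
        assume "\<not> d \<le> r"
        then have "m d \<le> m r"
          using d r by (intro m_anti) auto
        then show False
          using md elim(2) by simp
      qed
      have t: "t > 0"
        using elim(3) by simp
      \<comment> \<open>Zero lies in the spectrum, so the resolvent at \<open>\<i> d\<close> has norm at least \<open>1 / d\<close>; hence
        \<open>m d\<close> is at least a multiple of \<open>1 / d\<close>, while it is at most \<open>t\<close>.\<close>
      have "1 / t \<le> c * d"
      proof -
        have "1 \<le> \<bar>d\<bar> * onorm (shift_inv D A (\<i> * of_real d))"
          using d by (intro resolvent_lower_bound zero rho) auto
        also have "\<dots> \<le> \<bar>d\<bar> * (c * m \<bar>d\<bar>)"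
          using near[of d] d dr by (intro mult_left_mono) auto
        also have "\<dots> \<le> d * (c * t)"
        proof -
          have "t powr (1 - \<epsilon>) \<le> t powr 1"
            using elim(3) \<epsilon> by (intro powr_mono) auto
          then show ?thesis
            using d c(1) t md by (intro mult_mono) auto
        qed
        finally show ?thesis
          using t by (simp add: field_simps)
      qed
      moreover have "((c + K0) * m d / t) ^ k \<le> (c + K0) ^ k * (1 / t)"
      proof -
        have "t powr (1 - \<epsilon>) / t = t powr (- \<epsilon>)"
          using t by (simp add: powr_diff powr_minus divide_inverse)
        then have "(m d / t) ^ k = t powr (- \<epsilon> * real k)"
          using t by (simp add: md powr_realpow[symmetric] powr_powr)
        also have "\<dots> \<le> t powr (- 1)"
          using elim(3) k\<epsilon> by (intro powr_mono) (auto simp: mult.commute)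
        also have "\<dots> = 1 / t"
          using t by (simp add: powr_minus divide_inverse)
        finally have "(c + K0) ^ k * (m d / t) ^ k \<le> (c + K0) ^ k * (1 / t)"
          using c(1) K0(1) by (intro mult_left_mono) auto
        then show ?thesis
          by (simp add: power_mult_distrib[symmetric])
      qed
      moreover have "(c + K0) ^ k * (1 / t) \<le> (c + K0) ^ k * (c * d)"
        using \<open>1 / t \<le> c * d\<close> c(1) K0(1) by (intro mult_left_mono) auto
      ultimately have sum_le: "1 / t + d + ((c + K0) * m d / t) ^ k \<le> (c + 1 + (c + K0) ^ k * c) * d"
        by (simp add: algebra_simps)
      have "F t \<le> C * (1 / t + d + ((c + K0) * m d / t) ^ k)"
      proof (rule F_le)
        have K: "0 \<le> (c + K0) * m d"
          using c(1) K0(1) by (simp add: md)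
        show "norm (T t (B x)) \<le> C * (1 / t + d + ((c + K0) * m d / t) ^ k) * norm x" for x
          by (rule C(2)[OF t d(1) K away[OF d(1) dr]])
        show "0 \<le> C * (1 / t + d + ((c + K0) * m d / t) ^ k)"
          using C(1) t d(1) K by simp
      qed
      also have "\<dots> \<le> C * ((c + 1 + (c + K0) ^ k * c) * d)"
        by (intro mult_left_mono sum_le C)
      finally show ?case
        using F_nonneg[of t] t d(1) by (simp add: C'_def d_def mult.assoc)
    qed
    then show ?thesis
      by (rule bigoI)
  qed
  ultimately show ?thesis
    unfolding F_def by blast
qed

end
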